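(* Let $n\ge 2$, $p,q\geq 2$ be integers, $\mathcal{U}\in\mathbb{T}(\mathbb{C}^n,p)$ and $\mathcal{V}\in\mathbb{T}(\mathbb{C}^n,q)$. Then $$\mathrm{Edet}(\mathcal{U}\circ\mathcal{V})=0\quad\Longleftrightarrow\quad\mathrm{Edet}(\mathcal{U})\,\mathrm{Edet}(\mathcal{V})=0.$$
   Context: $\mathbb{T}(\mathbb{C}^n,m)$ is the space of $m$-th order $n$-dimensional complex tensors $\mathcal{T}=(t_{i_1\ldots i_m})$, $1\le i_1,\ldots,i_m\le n$. For $\mathbf{x}\in\mathbb{C}^n$, $\mathcal{T}\mathbf{x}^{m-1}\in\mathbb{C}^n$ is the vector with $i$-th entry $\sum_{i_2,\ldots,i_m=1}^n t_{ii_2\ldots i_m}x_{i_2}\cdots x_{i_m}$. The resultant $\mathrm{Res}$ of $n$ homogeneous polynomials in $n$ variables, each of degree $m-1$, is the irreducible polynomial in their coefficients that vanishes if and only if the polynomials have a common zero in $\mathbb{C}^n\setminus\{\mathbf{0}\}$, normalized by $\mathrm{Res}(x_1^{m-1},\ldots,x_n^{m-1})=1$. The E-determinant $\mathrm{Edet}(\mathcal{T})$ is the resultant of the $n$ components of $\mathcal{T}\mathbf{x}^{m-1}$. The composition $\mathcal{U}\circ\mathcal{V}\in\mathbb{T}(\mathbb{C}^n,1+(p-1)(q-1))$ is the tensor with entries $w_{iJ_2\ldots J_p}=\sum_{i_2,\ldots,i_p=1}^n u_{ii_2\ldots i_p}v_{i_2J_2}\cdots v_{i_pJ_p}$, where $J_2,\ldots,J_p\in\{1,\ldots,n\}^{q-1}$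 are multi-indices; it satisfies $(\mathcal{U}\circ\mathcal{V})\mathbf{x}^{(p-1)(q-1)}=\mathcal{U}(\mathcal{V}\mathbf{x}^{q-1})^{p-1}$. *)

theory Defs
  imports "HOL-Analysis.Finite_Cartesian_Product" "HOL-Computational_Algebra.Factorial_Ring"
    "HOL-Library.Poly_Mapping"
begin

section \<open>Complex polynomials in several variables\<close>

text \<open>Polynomials are finitely supported maps from exponent vectors to coefficients, with the
  convolution product of \<^theory>\<open>HOL-Library.Poly_Mapping\<close>.\<close>

type_synonym 'v cpoly = "('v \<Rightarrow>\<^sub>0 nat) \<Rightarrow>\<^sub>0 complex"

definition monom_degree :: "('v \<Rightarrow>\<^sub>0 nat) \<Rightarrow> nat" where
  "monom_degree a = (\<Sum>v\<in>Poly_Mapping.keys a. Poly_Mapping.lookup a v)"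

definition poly_vars :: "'v cpoly \<Rightarrow> 'v set" where
  "poly_vars P = (\<Union>a\<in>Poly_Mapping.keys P. Poly_Mapping.keys a)"

definition poly_eval :: "'v cpoly \<Rightarrow> ('v \<Rightarrow> complex) \<Rightarrow> complex" where
  "poly_eval P x = (\<Sum>a\<in>Poly_Mapping.keys P.
     Poly_Mapping.lookup P a * (\<Prod>v\<in>Poly_Mapping.keys a. x v ^ Poly_Mapping.lookup a v))"

definition homogeneous :: "nat \<Rightarrow> 'v cpoly \<Rightarrow> bool" where
  "homogeneous d P \<longleftrightarrow> (\<forall>a\<in>Poly_Mapping.keys P. monom_degree a = d)"

section \<open>The resultant\<close>

text \<open>A system of forms is a family \<open>F\<close> indexed by the same finite type \<open>'n\<close> as the variables.
  The pair \<open>(i, a)\<close> is the indeterminate that stands for the coefficient of the monomial with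
  exponent vector \<open>a\<close> in the form \<open>F i\<close>.\<close>

definition system_coeffs :: "('n \<Rightarrow> 'n cpoly) \<Rightarrow> 'n \<times> ('n \<Rightarrow>\<^sub>0 nat) \<Rightarrow> complex" where
  "system_coeffs F = (\<lambda>(i, a). Poly_Mapping.lookup (F i) a)"

definition pure_powers :: "nat \<Rightarrow> 'n \<Rightarrow> 'n cpoly" where
  "pure_powers d i = Poly_Mapping.single (Poly_Mapping.single i d) 1"

text \<open>Irreducibility is taken in the ring with an indeterminate \<open>(i, a)\<close> for every exponent
  vector \<open>a\<close>. As only those with \<open>monom_degree a = d\<close> occur in \<open>R\<close>, the same holds for all factors
  of \<open>R\<close>, and this is irreducibility in the ring of polynomials in the coefficients of forms of
  degree \<open>d\<close>.\<close>

definition is_resultant_poly :: "nat \<Rightarrow> ('n::finite \<times> ('n \<Rightarrow>\<^sub>0 nat)) cpoly \<Rightarrow> bool" where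
  "is_resultant_poly d R \<longleftrightarrow>
     poly_vars R \<subseteq> {(i, a). monom_degree a = d} \<and>
     irreducible R \<and>
     (\<forall>F. (\<forall>i. homogeneous d (F i)) \<longrightarrow>
        (poly_eval R (system_coeffs F) = 0 \<longleftrightarrow>
          (\<exists>x :: complex ^ 'n. x \<noteq> 0 \<and> (\<forall>i. poly_eval (F i) (($) x) = 0)))) \<and>
     poly_eval R (system_coeffs (pure_powers d)) = 1"

text \<open>For \<open>d \<ge> 1\<close> there is exactly one such polynomial, by classical elimination theory: by the
  Nullstellensatz the zero set determines an irreducible polynomial up to a scalar, which the
  normalization fixes. So the choice below is no choice.\<close>

definition resultant_poly :: "nat \<Rightarrow> ('n::finite \<times> ('n \<Rightarrow>\<^sub>0 nat)) cpoly" where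
  "resultant_poly d = (SOME R. is_resultant_poly d R)"

definition Res :: "nat \<Rightarrow> ('n::finite \<Rightarrow> 'n cpoly) \<Rightarrow> complex" where
  "Res d F = poly_eval (resultant_poly d) (system_coeffs F)"

section \<open>Tensors\<close>

text \<open>A tensor of order \<open>m\<close> and dimension \<open>CARD('n)\<close> is given by its entries at the index lists
  of length \<open>m\<close>. The order is a separate argument where it matters, and values at lists of other
  lengths are never used.\<close>

type_synonym 'n tensor = "'n list \<Rightarrow> complex"

text \<open>The \<open>i\<close>-th component of \<open>T x\<^sup>m\<^sup>-\<^sup>1\<close> as a polynomial in \<open>x\<close>: the summand of the index list
  \<open>J = [i\<^sub>2, \<dots>, i\<^sub>m]\<close> is the entry of \<open>T\<close> at \<open>i # J\<close> times the product of the variables in \<open>J\<close>.\<close>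

definition tensor_form :: "nat \<Rightarrow> 'n::finite tensor \<Rightarrow> 'n \<Rightarrow> 'n cpoly" where
  "tensor_form m T i = (\<Sum>J | length J = m - 1.
     Poly_Mapping.single (\<Sum>j\<leftarrow>J. Poly_Mapping.single j 1) (T (i # J)))"

definition Edet :: "nat \<Rightarrow> 'n::finite tensor \<Rightarrow> complex" where
  "Edet m T = Res (m - 1) (tensor_form m T)"

text \<open>The index list of an entry of the composition is \<open>i\<close> followed by the concatenation of
  \<open>p - 1\<close> blocks of length \<open>q - 1\<close>. Here \<open>index_block q k\<close> is block number \<open>k\<close>, counted from
  \<open>0\<close>, so it is \<open>J\<^sub>k\<^sub>+\<^sub>2\<close> in the usual numbering.\<close>

definition index_block :: "nat \<Rightarrow> nat \<Rightarrow> 'n list \<Rightarrow> 'n list" where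
  "index_block q k J = take (q - 1) (drop (k * (q - 1)) J)"

definition tensor_comp :: "nat \<Rightarrow> nat \<Rightarrow> 'n::finite tensor \<Rightarrow> 'n tensor \<Rightarrow> 'n tensor" where
  "tensor_comp p q U V = (\<lambda>L. \<Sum>I | length I = p - 1.
     U (hd L # I) * (\<Prod>k<p - 1. V (I ! k # index_block q k (tl L))))"

end

theory Submission
  imports Defs
    "HOL-Analysis.Brouwer_Fixpoint" "HOL-Analysis.Cartesian_Euclidean_Space"
    "HOL-Analysis.Complex_Transcendental" "HOL-Analysis.Continuum_Not_Denumerable"
    "HOL-Computational_Algebra.Field_as_Ring"
    "HOL-Computational_Algebra.Fundamental_Theorem_Algebra"
    "HOL-Computational_Algebra.Polynomial_Factorial"
begin

text \<open>Since \<open>(U \<circ> V) x = U (V x)\<close> as a map of \<open>x\<close>, a nontrivial zero of \<open>U \<circ> V\<close> gives one of \<open>V\<close> or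
  one of \<open>U\<close>, and conversely it remains to see that the map of \<open>V\<close> is surjective if its only zero is
  \<open>0\<close>. All of this is about zeros, so the existence of the resultant has to be shown first: the
  singular systems of forms (those with a nontrivial zero) are the zero set of one irreducible
  polynomial \<open>R\<close>. They are the image of an affine space, so the polynomials vanishing on them form a
  prime ideal, and by the Nullstellensatz they are cut out by these polynomials. Among the latter one
  is monic in the direction of the pure powers, while none except \<open>0\<close> is constant in this direction,
  so Gauss's lemma shows that the ideal is principal.

  Surjectivity follows from \<open>R\<close> as well. Scaling one form by \<open>s\<close> multiplies \<open>R\<close> by a factor that
  vanishes at \<open>s = 0\<close>, hence every system with a vanishing form is singular. Given \<open>y \<noteq> 0\<close>, the
  \<open>n - 1\<close> forms \<open>V\<^sub>i - (y\<^sub>i / y\<^sub>k) V\<^sub>k\<close> therefore have a common nontrivial zero \<open>x\<close>, where \<open>V x\<close> is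
  proportional to \<open>y\<close>.\<close>

section \<open>Polynomial functions\<close>

text \<open>Divisibility has to be controlled among polynomials in infinitely many indeterminates
  \<open>(i, a)\<close>, without factoriality of their ring. Polynomials are therefore treated as
  functions, which \<open>poly_eval_eqI\<close> justifies: substitution is composition, and
  restriction to lines reduces zero divisors, units and divisibility to one variable. The two inputs
  of Gauss's lemma have different sources. A member monic in the direction of the pure powers exists
  because the singular systems form a cone that misses the pure powers. That no nonzero member is
  constant in this direction is a statement about dimension; instead of dimension theory, Brouwer's
  fixed point theorem makes every system in a small box singular after a shift along the pure
  powers, and a polynomial function that vanishes on a box is 0. The factor by which scaling one
  form changes \<open>R\<close> is not computed from degrees of \<open>R\<close>. Divisibility by
  \<open>R\<close> for \<open>s\<close> and for \<open>1 / s\<close> makes it a unit if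
  \<open>s \<noteq> 0\<close>, and polynomial dependence on \<open>s\<close> carries the resulting
  identity to \<open>s = 0\<close>.\<close>

definition monom_eval :: "('v \<Rightarrow>\<^sub>0 nat) \<Rightarrow> ('v \<Rightarrow> complex) \<Rightarrow> complex" where
  "monom_eval a x = (\<Prod>v\<in>Poly_Mapping.keys a. x v ^ Poly_Mapping.lookup a v)"

lemma monom_eval_superset:
  assumes "finite V" "Poly_Mapping.keys a \<subseteq> V"
  shows "monom_eval a x = (\<Prod>v\<in>V. x v ^ Poly_Mapping.lookup a v)"
  unfolding monom_eval_def using assms
  by (intro prod.mono_neutral_left) (auto simp: in_keys_iff)

lemma monom_eval_zero [simp]: "monom_eval 0 x = 1"
  by (simp add: monom_eval_def)

lemma monom_eval_single [simp]: "monom_eval (Poly_Mapping.single v k) x = x v ^ k"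
  by (cases "k = 0") (simp_all add: monom_eval_def)

lemma monom_eval_add: "monom_eval (a + b) x = monom_eval a x * monom_eval b x"
proof -
  let ?V = "Poly_Mapping.keys a \<union> Poly_Mapping.keys b"
  have "monom_eval (a + b) x = (\<Prod>v\<in>?V. x v ^ Poly_Mapping.lookup (a + b) v)"
    by (intro monom_eval_superset) (auto simp: Poly_Mapping.keys_add)
  moreover have "monom_eval a x = (\<Prod>v\<in>?V. x v ^ Poly_Mapping.lookup a v)"
    "monom_eval b x = (\<Prod>v\<in>?V. x v ^ Poly_Mapping.lookup b v)"
    by (intro monom_eval_superset; auto)+
  ultimately show ?thesis
    by (simp add: lookup_add power_add prod.distrib)
qed

lemma monom_eval_mult: "monom_eval a (\<lambda>v. x v * y v) = monom_eval a x * monom_eval a y"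
  by (simp add: monom_eval_def power_mult_distrib prod.distrib)

lemma monom_eval_scale: "monom_eval a (\<lambda>v. s * x v) = s ^ monom_degree a * monom_eval a x"
  by (simp add: monom_eval_def monom_degree_def power_mult_distrib prod.distrib power_sum)

lemma poly_eval_superset:
  assumes "finite A" "Poly_Mapping.keys P \<subseteq> A"
  shows "poly_eval P x = (\<Sum>a\<in>A. Poly_Mapping.lookup P a * monom_eval a x)"
  unfolding poly_eval_def monom_eval_def[symmetric] using assms
  by (intro sum.mono_neutral_left) (auto simp: in_keys_iff)

lemma poly_eval_monoms:
  "poly_eval P x = (\<Sum>a\<in>Poly_Mapping.keys P. Poly_Mapping.lookup P a * monom_eval a x)"
  by (simp add: poly_eval_def monom_eval_def)

lemma poly_eval_zero [simp]: "poly_eval 0 x = 0"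
  by (simp add: poly_eval_def)

lemma poly_eval_single [simp]: "poly_eval (Poly_Mapping.single a k) x = k * monom_eval a x"
  by (cases "k = 0") (simp_all add: poly_eval_monoms)

lemma poly_eval_add: "poly_eval (P + Q) x = poly_eval P x + poly_eval Q x"
proof -
  let ?A = "Poly_Mapping.keys P \<union> Poly_Mapping.keys Q"
  have "poly_eval (P + Q) x = (\<Sum>a\<in>?A. Poly_Mapping.lookup (P + Q) a * monom_eval a x)"
    by (intro poly_eval_superset) (auto simp: Poly_Mapping.keys_add)
  moreover have "poly_eval P x = (\<Sum>a\<in>?A. Poly_Mapping.lookup P a * monom_eval a x)"
    "poly_eval Q x = (\<Sum>a\<in>?A. Poly_Mapping.lookup Q a * monom_eval a x)"
    by (intro poly_eval_superset; auto)+
  ultimately show ?thesis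
    by (simp add: lookup_add distrib_right sum.distrib)
qed

lemma poly_eval_sum: "poly_eval (\<Sum>i\<in>I. P i) x = (\<Sum>i\<in>I. poly_eval (P i) x)"
  by (induction I rule: infinite_finite_induct) (simp_all add: poly_eval_add)

lemma sum_singles_keys:
  fixes P :: "'a \<Rightarrow>\<^sub>0 'b :: comm_monoid_add"
  shows "(\<Sum>a\<in>Poly_Mapping.keys P. Poly_Mapping.single a (Poly_Mapping.lookup P a)) = P"
  by (rule poly_mapping_eqI)
    (auto simp: lookup_sum lookup_single when_def in_keys_iff)

lemma poly_eval_mult: "poly_eval (P * Q) x = poly_eval P x * poly_eval Q x"
proof -
  let ?s = "\<lambda>P a. Poly_Mapping.single a (Poly_Mapping.lookup P a)"
  have "P * Q = (\<Sum>a\<in>Poly_Mapping.keys P. ?s P a) * (\<Sum>b\<in>Poly_Mapping.keys Q. ?s Q b)"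
    by (simp add: sum_singles_keys)
  also have "poly_eval \<dots> x = (\<Sum>a\<in>Poly_Mapping.keys P. poly_eval (?s P a) x)
      * (\<Sum>b\<in>Poly_Mapping.keys Q. poly_eval (?s Q b) x)"
    by (simp add: sum_product poly_eval_sum mult_single monom_eval_add ac_simps)
  also have "\<dots> = poly_eval P x * poly_eval Q x"
    by (simp add: poly_eval_sum[symmetric] sum_singles_keys del: poly_eval_single)
  finally show ?thesis .
qed

lemma poly_eval_one [simp]: "poly_eval 1 x = 1"
  by (simp flip: single_one)

text \<open>Monomials are distinct homomorphisms of multiplicative monoids, so this is Dedekind's
  independence of characters.\<close>

lemma monom_eval_independent:
  assumes "finite A" "\<And>x. (\<Sum>a\<in>A. k a * monom_eval a x) = 0" "a \<in> A"
  shows "k a = 0"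
  using assms
proof (induction A arbitrary: k a rule: finite_induct)
  case empty
  then show ?case by simp
next
  case (insert b A)
  have zero: "k a = 0" if a: "a \<in> A" for a
  proof -
    from a insert.hyps have "a \<noteq> b" by auto
    then obtain v where v: "Poly_Mapping.lookup a v \<noteq> Poly_Mapping.lookup b v"
      using poly_mapping_eqI[of a b] by auto
    \<comment> \<open>Replacing \<open>x\<close> by the product with \<open>y\<close> multiplies the
      monomial \<open>c\<close> by \<open>2 ^ lookup c v\<close>. Subtracting
      \<open>monom_eval b y\<close> times the given relation removes \<open>b\<close>, while the
      factor at \<open>a\<close> stays nonzero because the exponents at \<open>v\<close>
      differ.\<close>
    define y :: "'a \<Rightarrow> complex" where "y w = (if w = v then 2 else 1)" for w
    have mon_y: "monom_eval c y = 2 ^ Poly_Mapping.lookup c v" for c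
    proof -
      have "monom_eval c y = (\<Prod>w\<in>insert v (Poly_Mapping.keys c). y w ^ Poly_Mapping.lookup c w)"
        by (intro monom_eval_superset) auto
      also have "\<dots> = (\<Prod>w\<in>insert v (Poly_Mapping.keys c).
          if w = v then 2 ^ Poly_Mapping.lookup c v else 1)"
        by (intro prod.cong) (auto simp: y_def)
      finally show ?thesis by simp
    qed
    have "(\<Sum>a\<in>A. (k a * (monom_eval a y - monom_eval b y)) * monom_eval a x) = 0" for x
    proof -
      have "(\<Sum>a\<in>insert b A. k a * monom_eval a (\<lambda>v. y v * x v))
          - monom_eval b y * (\<Sum>a\<in>insert b A. k a * monom_eval a x) = 0"
        using insert.prems(1) by simp
      then show ?thesis
        using insert.hyps
        by (simp add: monom_eval_mult algebra_simps sum.distrib sum_distrib_left sum_subtractf)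
    qed
    from insert.IH[OF this a] have "k a = 0 \<or> monom_eval a y = monom_eval b y"
      by simp
    moreover have "monom_eval a y \<noteq> monom_eval b y"
      using v unfolding mon_y
      by (metis of_nat_eq_iff of_nat_numeral of_nat_power power_inject_exp one_less_numeral_iff semiring_norm(76))
    ultimately show ?thesis by simp
  qed
  have "k b = 0"
    using insert.prems(1)[of "\<lambda>_. 1"] insert.hyps zero by (simp add: monom_eval_def)
  with zero insert.prems show ?case by auto
qed

lemma poly_eval_eqI:
  assumes "\<And>x. poly_eval P x = poly_eval Q x"
  shows "P = Q"
proof (rule poly_mapping_eqI)
  fix a
  let ?A = "insert a (Poly_Mapping.keys P \<union> Poly_Mapping.keys Q)"
  have "(\<Sum>a\<in>?A. (Poly_Mapping.lookup P a - Poly_Mapping.lookup Q a) * monom_eval a x) = 0" for x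
  proof -
    have "poly_eval P x = (\<Sum>a\<in>?A. Poly_Mapping.lookup P a * monom_eval a x)"
      "poly_eval Q x = (\<Sum>a\<in>?A. Poly_Mapping.lookup Q a * monom_eval a x)"
      by (intro poly_eval_superset; auto)+
    then show ?thesis
      using assms[of x] by (simp only: left_diff_distrib sum_subtractf) simp
  qed
  from monom_eval_independent[OF _ this, of a]
  show "Poly_Mapping.lookup P a = Poly_Mapping.lookup Q a" by simp
qed

definition polyfuns :: "(('v \<Rightarrow> complex) \<Rightarrow> complex) set" where
  "polyfuns = range poly_eval"

lemma polyfuns_obtain:
  assumes "f \<in> polyfuns"
  obtains A k where "finite A" "f = (\<lambda>x. \<Sum>a\<in>A. k a * monom_eval a x)"
proof -
  from assms obtain P where "f = poly_eval P"
    by (auto simp: polyfuns_def)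
  then show ?thesis
    by (intro that[of "Poly_Mapping.keys P" "Poly_Mapping.lookup P"]) (auto simp: poly_eval_monoms)
qed

lemma polyfuns_const [simp]: "(\<lambda>x. k) \<in> polyfuns"
  unfolding polyfuns_def by (rule range_eqI[of _ _ "Poly_Mapping.single 0 k"]) auto

lemma polyfuns_monom_eval: "monom_eval a \<in> polyfuns"
  unfolding polyfuns_def by (rule range_eqI[of _ _ "Poly_Mapping.single a 1"]) auto

lemma polyfuns_var [simp]: "(\<lambda>x. x v) \<in> polyfuns"
  unfolding polyfuns_def by (rule range_eqI[of _ _ "Poly_Mapping.single (Poly_Mapping.single v 1) 1"]) auto

lemma polyfuns_add:
  assumes "f \<in> polyfuns" "g \<in> polyfuns"
  shows "(\<lambda>x. f x + g x) \<in> polyfuns"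
  using assms unfolding polyfuns_def by (auto simp: fun_eq_iff simp flip: poly_eval_add)

lemma polyfuns_mult:
  assumes "f \<in> polyfuns" "g \<in> polyfuns"
  shows "(\<lambda>x. f x * g x) \<in> polyfuns"
  using assms unfolding polyfuns_def by (auto simp: fun_eq_iff simp flip: poly_eval_mult)

lemma polyfuns_diff:
  assumes "f \<in> polyfuns" "g \<in> polyfuns"
  shows "(\<lambda>x. f x - g x) \<in> polyfuns"
  using polyfuns_add[OF assms(1) polyfuns_mult[OF polyfuns_const[of "-1"] assms(2)]] by simp

lemma polyfuns_sum:
  "(\<And>i. i \<in> I \<Longrightarrow> f i \<in> polyfuns) \<Longrightarrow> (\<lambda>x. \<Sum>i\<in>I. f i x) \<in> polyfuns"
  by (induction I rule: infinite_finite_induct) (simp_all add: polyfuns_add)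

lemma polyfuns_prod:
  "(\<And>i. i \<in> I \<Longrightarrow> f i \<in> polyfuns) \<Longrightarrow> (\<lambda>x. \<Prod>i\<in>I. f i x) \<in> polyfuns"
  by (induction I rule: infinite_finite_induct) (simp_all add: polyfuns_mult)

lemma polyfuns_power: "f \<in> polyfuns \<Longrightarrow> (\<lambda>x. f x ^ n) \<in> polyfuns"
  by (induction n) (simp_all add: polyfuns_mult)

lemma polyfuns_compose:
  assumes "f \<in> polyfuns" "\<And>v. (\<lambda>z. g z v) \<in> polyfuns"
  shows "(\<lambda>z. f (g z)) \<in> polyfuns"
proof -
  from assms(1) obtain A k where "finite A" and f: "f = (\<lambda>x. \<Sum>a\<in>A. k a * monom_eval a x)"
    by (rule polyfuns_obtain)
  show ?thesis
    unfolding f monom_eval_def by (intro polyfuns_sum polyfuns_mult polyfuns_prod polyfuns_power assms polyfuns_const)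
qed

subsection \<open>Polynomial curves\<close>

lemma range_poly_const [simp]: "(\<lambda>s. k) \<in> range (poly :: complex poly \<Rightarrow> _)"
  by (rule range_eqI[of _ _ "[:k:]"]) auto

lemma range_poly_id [simp]: "(\<lambda>s. s) \<in> range (poly :: complex poly \<Rightarrow> _)"
  by (rule range_eqI[of _ _ "[:0, 1:]"]) auto

lemma range_poly_add:
  assumes "f \<in> range (poly :: complex poly \<Rightarrow> _)" "g \<in> range poly"
  shows "(\<lambda>s. f s + g s) \<in> range poly"
proof -
  from assms obtain p q where "f = poly p" "g = poly q" by auto
  then show ?thesis by (intro range_eqI[of _ _ "p + q"]) auto
qed

lemma range_poly_diff:
  assumes "f \<in> range (poly :: complex poly \<Rightarrow> _)" "g \<in> range poly"
  shows "(\<lambda>s. f s - g s) \<in> range poly"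
proof -
  from assms obtain p q where "f = poly p" "g = poly q" by auto
  then show ?thesis by (intro range_eqI[of _ _ "p - q"]) auto
qed

lemma range_poly_mult:
  assumes "f \<in> range (poly :: complex poly \<Rightarrow> _)" "g \<in> range poly"
  shows "(\<lambda>s. f s * g s) \<in> range poly"
proof -
  from assms obtain p q where "f = poly p" "g = poly q" by auto
  then show ?thesis by (intro range_eqI[of _ _ "p * q"]) auto
qed

lemma range_poly_sum:
  "(\<And>i. i \<in> I \<Longrightarrow> f i \<in> range (poly :: complex poly \<Rightarrow> _)) \<Longrightarrow> (\<lambda>s. \<Sum>i\<in>I. f i s) \<in> range poly"
  by (induction I rule: infinite_finite_induct) (simp_all add: range_poly_add del: image_iff)

lemma range_poly_prod:
  "(\<And>i. i \<in> I \<Longrightarrow> f i \<in> range (poly :: complex poly \<Rightarrow> _)) \<Longrightarrow> (\<lambda>s. \<Prod>i\<in>I. f i s) \<in> range poly"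
  by (induction I rule: infinite_finite_induct) (simp_all add: range_poly_mult del: image_iff)

lemma range_poly_power:
  "f \<in> range (poly :: complex poly \<Rightarrow> _) \<Longrightarrow> (\<lambda>s. f s ^ n) \<in> range poly"
  by (induction n) (simp_all add: range_poly_mult del: image_iff)

text \<open>The passage to one variable: along a curve, finiteness of roots and the fundamental
  theorem of algebra become available.\<close>

lemma polyfuns_curve:
  assumes "f \<in> polyfuns" "\<And>v. (\<lambda>s. g s v) \<in> range (poly :: complex poly \<Rightarrow> _)"
  shows "(\<lambda>s. f (g s)) \<in> range poly"
proof -
  from assms(1) obtain A k where "finite A" and f: "f = (\<lambda>x. \<Sum>a\<in>A. k a * monom_eval a x)"
    by (rule polyfuns_obtain)
  show ?thesis
    unfolding f monom_eval_def
    by (intro range_poly_sum range_poly_mult range_poly_prod range_poly_power range_poly_const assms)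
qed

lemma polyfuns_line:
  assumes "f \<in> polyfuns"
  shows "(\<lambda>s. f (\<lambda>v. x v + s * y v)) \<in> range poly"
  using assms by (rule polyfuns_curve) (intro range_poly_add range_poly_mult range_poly_const range_poly_id)

lemma range_poly_eq_zero:
  assumes "f \<in> range (poly :: complex poly \<Rightarrow> _)" "infinite {s. f s = 0}"
  shows "f s = 0"
proof -
  from assms(1) obtain p where p: "f = poly p" by auto
  have "p = 0" using assms(2) poly_roots_finite unfolding p by blast
  then show ?thesis by (simp add: p)
qed

lemma range_poly_mult_eq_zero:
  assumes "f \<in> range (poly :: complex poly \<Rightarrow> _)" "g \<in> range poly" "\<And>s. f s * g s = 0"
  shows "f s = 0 \<or> g t = 0"
proof -
  from assms(1,2) obtain p q where pq: "f = poly p" "g = poly q" by auto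
  have "poly (p * q) = poly 0" using assms(3) by (auto simp: fun_eq_iff pq)
  then have "p * q = 0" by (simp only: poly_eq_poly_eq_iff)
  then show ?thesis by (auto simp: pq)
qed

lemma range_poly_nonzero_const:
  assumes "f \<in> range (poly :: complex poly \<Rightarrow> _)" "\<And>s. f s \<noteq> 0"
  shows "f s = f t"
proof -
  from assms(1) obtain p where p: "f = poly p" by auto
  have "constant (poly p)"
    using assms(2) fundamental_theorem_of_algebra unfolding p by blast
  then show ?thesis by (simp add: constant_def p)
qed

text \<open>The line through \<open>x\<close> and \<open>y\<close> reduces this to the absence of
  zero divisors among univariate polynomials. As the two points are independent, one factor is
  identically 0.\<close>

lemma polyfuns_mult_eq_zero:
  assumes "f \<in> polyfuns" "g \<in> polyfuns" "\<And>x. f x * g x = 0"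
  shows "f x = 0 \<or> g y = 0"
proof -
  have "f (\<lambda>v. x v + 0 * (y v - x v)) = 0 \<or> g (\<lambda>v. x v + 1 * (y v - x v)) = 0"
    by (rule range_poly_mult_eq_zero[where f = "\<lambda>s. f (\<lambda>v. x v + s * (y v - x v))" and
          g = "\<lambda>s. g (\<lambda>v. x v + s * (y v - x v))"]) (use assms polyfuns_line in auto)
  then show ?thesis by simp
qed

lemma polyfuns_mult_cancel:
  assumes "f \<in> polyfuns" "g \<in> polyfuns" "h \<in> polyfuns" "h y \<noteq> 0" "\<And>x. f x * h x = g x * h x"
  shows "f x = g x"
  using polyfuns_mult_eq_zero[OF polyfuns_diff[OF assms(1,2)] assms(3), of x y] assms(4,5)
  by (auto simp: algebra_simps)

lemma polyfuns_nonzero_const: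
  assumes "f \<in> polyfuns" "\<And>x. f x \<noteq> 0"
  shows "f x = f y"
proof -
  have "f (\<lambda>v. x v + 0 * (y v - x v)) = f (\<lambda>v. x v + 1 * (y v - x v))"
    by (rule range_poly_nonzero_const[where f = "\<lambda>s. f (\<lambda>v. x v + s * (y v - x v))"])
      (use assms polyfuns_line in auto)
  then show ?thesis by simp
qed

text \<open>On the line from \<open>y\<close> to \<open>x\<close> all small parameters stay in the
  box, which gives infinitely many roots. Only the coordinates in \<open>W\<close> are constrained,
  so there may be infinitely many others.\<close>

lemma polyfuns_eq_zero_of_box:
  assumes "f \<in> polyfuns" "finite W" "e > 0"
    and zero: "\<And>x. (\<And>v. v \<in> W \<Longrightarrow> norm (x v - y v) \<le> e) \<Longrightarrow> f x = 0"
  shows "f x = 0"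
proof -
  define K where "K = 1 + (\<Sum>v\<in>W. norm (x v - y v))"
  have K: "K > 0" "norm (x v - y v) \<le> K" if "v \<in> W" for v
    using that assms(2) member_le_sum[of v W "\<lambda>v. norm (x v - y v)"]
    by (auto simp: K_def intro!: add_pos_nonneg sum_nonneg)
  have "K > 0" by (auto simp: K_def intro!: add_pos_nonneg sum_nonneg)
  have "f (\<lambda>v. y v + 1 * (x v - y v)) = 0"
  proof (rule range_poly_eq_zero[where f = "\<lambda>s. f (\<lambda>v. y v + s * (x v - y v))"])
    have "cball 0 (e / K) \<subseteq> {s. f (\<lambda>v. y v + s * (x v - y v)) = 0}"
    proof clarify
      fix s :: complex assume s: "s \<in> cball 0 (e / K)"
      show "f (\<lambda>v. y v + s * (x v - y v)) = 0"
      proof (rule zero)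
        fix v assume "v \<in> W"
        then have "norm s * norm (x v - y v) \<le> e / K * K"
          using s K(2) \<open>K > 0\<close> \<open>e > 0\<close> by (intro mult_mono) auto
        then show "norm (y v + s * (x v - y v) - y v) \<le> e"
          using \<open>K > 0\<close> by (simp add: norm_mult)
      qed
    qed
    moreover have "infinite (cball (0::complex) (e / K))"
      using \<open>K > 0\<close> \<open>e > 0\<close> by (intro uncountable_infinite uncountable_cball) simp
    ultimately show "infinite {s. f (\<lambda>v. y v + s * (x v - y v)) = 0}"
      using finite_subset by blast
  qed (use assms polyfuns_line in auto)
  then show ?thesis by simp
qed

section \<open>Families of univariate polynomials\<close>

text \<open>These are the polynomials in one variable \<open>t\<close> over the ring of polynomial
  functions of \<open>c\<close>. The uniform degree bound leaves only finitely many coefficient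
  functions that are not identically 0.\<close>

definition polyfams :: "(('v \<Rightarrow> complex) \<Rightarrow> complex poly) set" where
  "polyfams = {p. (\<exists>k. \<forall>c. degree (p c) \<le> k) \<and> (\<forall>j. (\<lambda>c. coeff (p c) j) \<in> polyfuns)}"

lemma polyfams_degree_bound:
  assumes "p \<in> polyfams"
  shows "\<exists>k. \<forall>c. degree (p c) \<le> k"
  using assms by (simp add: polyfams_def)

lemma polyfams_coeff: "p \<in> polyfams \<Longrightarrow> (\<lambda>c. coeff (p c) j) \<in> polyfuns"
  by (simp add: polyfams_def)

lemma polyfamsI:
  assumes "\<And>c. degree (p c) \<le> k" "\<And>j. (\<lambda>c. coeff (p c) j) \<in> polyfuns"
  shows "p \<in> polyfams"
  using assms by (auto simp: polyfams_def)

lemma polyfuns_if: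
  "f \<in> polyfuns \<Longrightarrow> g \<in> polyfuns \<Longrightarrow> (\<lambda>c. if b then f c else g c) \<in> polyfuns"
  by (cases b) auto

lemma polyfams_monom: "f \<in> polyfuns \<Longrightarrow> (\<lambda>c. monom (f c) n) \<in> polyfams"
  by (rule polyfamsI[of _ n]) (simp_all add: degree_monom_le polyfuns_if)

lemma polyfams_const: "(\<lambda>c. p) \<in> polyfams"
  by (rule polyfamsI[of _ "degree p"]) simp_all

lemma polyfams_add:
  assumes "p \<in> polyfams" "q \<in> polyfams"
  shows "(\<lambda>c. p c + q c) \<in> polyfams"
proof -
  obtain k l where "\<And>c. degree (p c) \<le> k" "\<And>c. degree (q c) \<le> l"
    using polyfams_degree_bound[OF assms(1)] polyfams_degree_bound[OF assms(2)] by auto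
  then have "degree (p c + q c) \<le> max k l" for c
    by (intro degree_add_le) (simp_all add: le_max_iff_disj)
  moreover have "(\<lambda>c. coeff (p c + q c) j) \<in> polyfuns" for j
    unfolding coeff_add using assms by (intro polyfuns_add polyfams_coeff)
  ultimately show ?thesis
    by (rule polyfamsI)
qed

lemma polyfams_mult:
  assumes "p \<in> polyfams" "q \<in> polyfams"
  shows "(\<lambda>c. p c * q c) \<in> polyfams"
proof -
  obtain k l where "\<And>c. degree (p c) \<le> k" "\<And>c. degree (q c) \<le> l"
    using polyfams_degree_bound[OF assms(1)] polyfams_degree_bound[OF assms(2)] by auto
  then have "degree (p c * q c) \<le> k + l" for c
    by (meson add_mono degree_mult_le order.trans)
  moreover have "(\<lambda>c. coeff (p c * q c) j) \<in> polyfuns" for j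
    unfolding coeff_mult using assms by (intro polyfuns_sum polyfuns_mult polyfams_coeff)
  ultimately show ?thesis
    by (rule polyfamsI)
qed

lemma polyfams_smult:
  assumes "f \<in> polyfuns" "p \<in> polyfams"
  shows "(\<lambda>c. smult (f c) (p c)) \<in> polyfams"
  using polyfams_mult[OF polyfams_monom[OF assms(1), of 0] assms(2)] by (simp add: monom_0)

lemma polyfams_diff:
  assumes "p \<in> polyfams" "q \<in> polyfams"
  shows "(\<lambda>c. p c - q c) \<in> polyfams"
  using polyfams_add[OF assms(1) polyfams_smult[OF polyfuns_const[of "-1"] assms(2)]] by simp

lemma polyfams_sum:
  "(\<And>i. i \<in> I \<Longrightarrow> p i \<in> polyfams) \<Longrightarrow> (\<lambda>c. \<Sum>i\<in>I. p i c) \<in> polyfams"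
  by (induction I rule: infinite_finite_induct) (simp_all add: polyfams_add polyfams_const)

lemma polyfams_prod:
  "(\<And>i. i \<in> I \<Longrightarrow> p i \<in> polyfams) \<Longrightarrow> (\<lambda>c. \<Prod>i\<in>I. p i c) \<in> polyfams"
  by (induction I rule: infinite_finite_induct) (simp_all add: polyfams_mult polyfams_const)

lemma polyfams_power: "p \<in> polyfams \<Longrightarrow> (\<lambda>c. p c ^ n) \<in> polyfams"
  by (induction n) (simp_all add: polyfams_mult polyfams_const)

section \<open>Top coefficients and expansion along a direction\<close>

lemma poly_bounded_sum:
  fixes p :: "'a :: comm_semiring_1 poly"
  assumes "degree p \<le> k"
  shows "poly p x = (\<Sum>i\<le>k. coeff p i * x ^ i)"
  unfolding poly_altdef using assms
  by (intro sum.mono_neutral_left) (auto simp: coeff_eq_0)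

lemma polyfams_poly:
  assumes "p \<in> polyfams"
  shows "(\<lambda>c. poly (p c) t) \<in> polyfuns"
proof -
  obtain k where "\<And>c. degree (p c) \<le> k"
    using polyfams_degree_bound[OF assms] by auto
  then have "(\<lambda>c. poly (p c) t) = (\<lambda>c. \<Sum>i\<le>k. coeff (p c) i * t ^ i)"
    by (auto simp: poly_bounded_sum)
  moreover have "(\<lambda>c. \<Sum>i\<le>k. coeff (p c) i * t ^ i) \<in> polyfuns"
    using assms by (intro polyfuns_sum polyfuns_mult polyfams_coeff polyfuns_const)
  ultimately show ?thesis by simp
qed

text \<open>If a bound is not attained, both sides are 0. Bounds replace degrees because the degree
  of a family may drop at special base points.\<close>

lemma coeff_mult_degree_bounds:
  fixes p q :: "'a :: comm_semiring_0 poly"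
  assumes "degree p \<le> m" "degree q \<le> n"
  shows "coeff (p * q) (m + n) = coeff p m * coeff q n"
proof (cases "degree p = m \<and> degree q = n")
  case True
  then show ?thesis by (auto simp: coeff_mult_degree_sum)
next
  case False
  with assms have "degree p + degree q < m + n" and "degree p < m \<or> degree q < n"
    by auto
  then show ?thesis
    using degree_mult_le[of p q] by (auto simp: coeff_eq_0)
qed

lemma coeff_prod_degree_bounds:
  fixes p :: "'i \<Rightarrow> 'a :: comm_semiring_1 poly"
  assumes "finite I" "\<And>i. i \<in> I \<Longrightarrow> degree (p i) \<le> n i"
  shows "degree (\<Prod>i\<in>I. p i) \<le> (\<Sum>i\<in>I. n i)"
    and "coeff (\<Prod>i\<in>I. p i) (\<Sum>i\<in>I. n i) = (\<Prod>i\<in>I. coeff (p i) (n i))"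
proof -
  have "degree (\<Prod>i\<in>I. p i) \<le> (\<Sum>i\<in>I. n i) \<and>
      coeff (\<Prod>i\<in>I. p i) (\<Sum>i\<in>I. n i) = (\<Prod>i\<in>I. coeff (p i) (n i))"
    using assms
  proof (induction I rule: finite_induct)
    case (insert i I)
    then have "degree (p i * (\<Prod>i\<in>I. p i)) \<le> n i + (\<Sum>i\<in>I. n i)"
      by (intro order.trans[OF degree_mult_le] add_mono) auto
    with insert show ?case by (simp add: coeff_mult_degree_bounds)
  qed auto
  then show "degree (\<Prod>i\<in>I. p i) \<le> (\<Sum>i\<in>I. n i)"
    and "coeff (\<Prod>i\<in>I. p i) (\<Sum>i\<in>I. n i) = (\<Prod>i\<in>I. coeff (p i) (n i))" by auto
qed

lemma coeff_top_linear_power: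
  fixes a b :: "'a :: comm_semiring_1"
  shows "degree ([:a, b:] ^ n) \<le> n" "coeff ([:a, b:] ^ n) n = b ^ n"
  using coeff_prod_degree_bounds[of "{..<n}" "\<lambda>_. [:a, b:]" "\<lambda>_. 1"] by auto

text \<open>Each monomial becomes a product of linear factors in \<open>s\<close>, and only those of
  degree \<open>m\<close> reach \<open>s ^ m\<close>, with the coefficient
  \<open>monom_eval a v\<close>. So the top coefficient does not depend on the base point.\<close>

lemma polyfams_expand_graded:
  assumes A: "finite A" "\<And>a. a \<in> A \<Longrightarrow> monom_degree a \<le> m"
  obtains p where "p \<in> polyfams"
    "\<And>c s. poly (p c) s = (\<Sum>a\<in>A. k a * monom_eval a (\<lambda>w. c w + s * v w))"
    "\<And>c. degree (p c) \<le> m"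
    "\<And>c. coeff (p c) m = (\<Sum>a | a \<in> A \<and> monom_degree a = m. k a * monom_eval a v)"
proof
  define q where "q a c = (\<Prod>w\<in>Poly_Mapping.keys a. [:c w, v w:] ^ Poly_Mapping.lookup a w)"
    for a and c :: "'a \<Rightarrow> complex"
  define p where "p c = (\<Sum>a\<in>A. smult (k a) (q a c))" for c
  have linear: "(\<lambda>c. [:c w, v w:]) \<in> polyfams" for w
  proof -
    have "(\<lambda>c. [:c w, v w:]) = (\<lambda>c. monom (c w) 0 + monom (v w) 1)"
      by (simp add: fun_eq_iff monom_altdef)
    then show ?thesis by (simp only: polyfams_add polyfams_monom polyfuns_var polyfuns_const)
  qed
  show "p \<in> polyfams"
    unfolding p_def q_def by (intro polyfams_sum polyfams_smult polyfams_prod polyfams_power linear polyfuns_const)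
  show "poly (p c) s = (\<Sum>a\<in>A. k a * monom_eval a (\<lambda>w. c w + s * v w))" for c s
    by (simp add: p_def q_def poly_sum poly_prod poly_power monom_eval_def)
  have deg: "degree (q a c) \<le> monom_degree a" for a c
    unfolding q_def monom_degree_def by (intro coeff_prod_degree_bounds coeff_top_linear_power) auto
  have top: "coeff (q a c) (monom_degree a) = monom_eval a v" for a c
    unfolding q_def monom_degree_def monom_eval_def
    by (subst coeff_prod_degree_bounds) (auto simp: coeff_top_linear_power)
  show "degree (p c) \<le> m" for c
    unfolding p_def using A deg
    by (intro degree_sum_le) (auto intro: order.trans[OF degree_smult_le] order.trans[OF deg])
  have "coeff (p c) m = (\<Sum>a\<in>A. if monom_degree a = m then k a * monom_eval a v else 0)" for c
    unfolding p_def coeff_sum coeff_smult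
  proof (intro sum.cong refl)
    fix a assume "a \<in> A"
    then have "monom_degree a < m" if "monom_degree a \<noteq> m"
      using A(2) that by (simp add: nat_less_le)
    then show "k a * coeff (q a c) m = (if monom_degree a = m then k a * monom_eval a v else 0)"
      using top[of a c] deg[of a c] by (auto simp: coeff_eq_0)
  qed
  then show "coeff (p c) m = (\<Sum>a | a \<in> A \<and> monom_degree a = m. k a * monom_eval a v)" for c
    using A(1) by (simp add: sum.If_cases Int_def)
qed

lemma polyfams_expand:
  assumes "f \<in> polyfuns"
  obtains p where "p \<in> polyfams" "\<And>c s. poly (p c) s = f (\<lambda>w. c w + s * v w)"
proof -
  from assms obtain A k where "finite A" and f: "f = (\<lambda>x. \<Sum>a\<in>A. k a * monom_eval a x)"
    by (rule polyfuns_obtain)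
  then show ?thesis
    by (rule_tac polyfams_expand_graded[of A "\<Sum>a\<in>A. monom_degree a" k v])
      (auto intro!: that member_le_sum)
qed

text \<open>Coefficients cannot be divided, so each step of long division multiplies by the leading
  coefficient of \<open>g\<close> instead. The remainder is bounded by vanishing coefficients rather
  than by its degree, so that \<open>e = 0\<close> forces it to be 0.\<close>

lemma polyfams_pseudo_divide:
  assumes g: "g \<in> polyfams" "\<And>c. degree (g c) \<le> e" and f: "f \<in> polyfams"
  shows "\<exists>N. \<exists>q\<in>polyfams. \<exists>r\<in>polyfams.
    (\<forall>c. smult (coeff (g c) e ^ N) (f c) = q c * g c + r c) \<and> (\<forall>c. \<forall>j\<ge>e. coeff (r c) j = 0)"
proof -
  have "\<exists>N. \<exists>q\<in>polyfams. \<exists>r\<in>polyfams.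
      (\<forall>c. smult (coeff (g c) e ^ N) (f c) = q c * g c + r c) \<and> (\<forall>c. \<forall>j\<ge>e. coeff (r c) j = 0)"
    if "\<forall>c. \<forall>j\<ge>k. coeff (f c) j = 0" "f \<in> polyfams" for k f
    using that
  proof (induction k arbitrary: f)
    case 0
    then show ?case
      by (intro exI[of _ 0] bexI[of _ "\<lambda>_. 0"] bexI[of _ f]) (auto intro: polyfams_const)
  next
    case (Suc k)
    show ?case
    proof (cases "k \<ge> e")
      case False
      with Suc.prems show ?thesis
        by (intro exI[of _ 0] bexI[of _ "\<lambda>_. 0"] bexI[of _ f]) (auto intro: polyfams_const)
    next
      case True
      define m where "m c = monom (coeff (f c) k) (k - e)" for c
      define f' where "f' c = smult (coeff (g c) e) (f c) - m c * g c" for c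
      have m: "m \<in> polyfams"
        unfolding m_def using Suc.prems by (intro polyfams_monom polyfams_coeff)
      have "f' \<in> polyfams"
        unfolding f'_def using Suc.prems g m by (intro polyfams_diff polyfams_smult polyfams_coeff polyfams_mult)
      moreover have "coeff (f' c) j = 0" if "j \<ge> k" for c j
      proof (cases "j = k")
        case True
        then show ?thesis using \<open>k \<ge> e\<close>
          by (simp add: f'_def m_def coeff_monom_mult)
      next
        case False
        with that have "j \<ge> Suc k" by simp
        moreover from this have "coeff (g c) (j - (k - e)) = 0"
          using \<open>k \<ge> e\<close> g(2)[of c] by (intro coeff_eq_0) linarith
        ultimately show ?thesis using Suc.prems
          by (simp add: f'_def m_def coeff_monom_mult)
      qed
      ultimately obtain N q r where IH: "q \<in> polyfams" "r \<in> polyfams"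
        "\<And>c. smult (coeff (g c) e ^ N) (f' c) = q c * g c + r c"
        "\<And>c j. j \<ge> e \<Longrightarrow> coeff (r c) j = 0"
        using Suc.IH[of f'] by auto
      have "smult (coeff (g c) e ^ Suc N) (f c) = (q c + smult (coeff (g c) e ^ N) (m c)) * g c + r c" for c
        using IH(3)[of c] by (simp add: f'_def algebra_simps smult_diff_right smult_add_right)
      moreover have "(\<lambda>c. q c + smult (coeff (g c) e ^ N) (m c)) \<in> polyfams"
        using IH m g by (intro polyfams_add polyfams_smult polyfuns_power polyfams_coeff)
      ultimately show ?thesis using IH
        by (intro exI[of _ "Suc N"] bexI[of _ "\<lambda>c. q c + smult (coeff (g c) e ^ N) (m c)"] bexI[of _ r]) auto
    qed
  qed
  moreover obtain k where "\<And>c. degree (f c) \<le> k"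
    using polyfams_degree_bound[OF f] by auto
  then have "\<forall>c. \<forall>j\<ge>Suc k. coeff (f c) j = 0"
    by (auto intro!: coeff_eq_0 simp: Suc_le_eq intro: le_less_trans)
  ultimately show ?thesis using f by blast
qed

text \<open>In a direction along which \<open>l\<close> has constant leading coefficient, division with remainder
  stays polynomial in the base point, and the remainder vanishes on every line.\<close>

lemma polyfuns_dvd_of_lines:
  assumes l: "l \<in> polyfuns" "l y \<noteq> 0" and f: "f \<in> polyfuns"
    and dvd: "\<And>c v p q. poly p = (\<lambda>s. l (\<lambda>w. c w + s * v w)) \<Longrightarrow>
      poly q = (\<lambda>s. f (\<lambda>w. c w + s * v w)) \<Longrightarrow> p \<noteq> 0 \<Longrightarrow> p dvd q"
  shows "\<exists>q\<in>polyfuns. \<forall>c. f c = q c * l c"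
proof -
  from l(1) obtain A0 k where "finite A0" and l0: "l = (\<lambda>x. \<Sum>a\<in>A0. k a * monom_eval a x)"
    by (rule polyfuns_obtain)
  \<comment> \<open>Zero coefficients are discarded so that \<open>m\<close> below is the true
    degree of \<open>l\<close> and its homogeneous top part \<open>h\<close> is not identically
    0.\<close>
  define A where "A = {a\<in>A0. k a \<noteq> 0}"
  have A: "finite A" and l_eq: "l x = (\<Sum>a\<in>A. k a * monom_eval a x)" for x
    unfolding A_def l0 using \<open>finite A0\<close> by (auto intro!: sum.mono_neutral_right)
  have "A \<noteq> {}" using l(2) by (auto simp: l_eq)
  define m where "m = Max (monom_degree ` A)"
  have m: "monom_degree a \<le> m" if "a \<in> A" for a
    using A that by (simp add: m_def)
  have "m \<in> monom_degree ` A"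
    unfolding m_def using A \<open>A \<noteq> {}\<close> by (intro Max_in) auto
  then obtain b where b: "b \<in> A" "monom_degree b = m" by auto
  define h where "h v = (\<Sum>a | a \<in> A \<and> monom_degree a = m. k a * monom_eval a v)" for v
  have "\<exists>v. h v \<noteq> 0"
  proof (rule ccontr)
    assume "\<nexists>v. h v \<noteq> 0"
    then have "k b = 0"
      using A b by (intro monom_eval_independent[of "{a \<in> A. monom_degree a = m}" k b]) (auto simp: h_def)
    with b show False by (simp add: A_def)
  qed
  then obtain v where v: "h v \<noteq> 0" by auto
  obtain L where L: "L \<in> polyfams" "\<And>c s. poly (L c) s = l (\<lambda>w. c w + s * v w)"
    "\<And>c. degree (L c) \<le> m" "\<And>c. coeff (L c) m = h v"
    using polyfams_expand_graded[OF A m, of k v] unfolding l_eq h_def by blast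
  obtain F where F: "F \<in> polyfams" "\<And>c s. poly (F c) s = f (\<lambda>w. c w + s * v w)"
    using polyfams_expand[OF f] by blast
  obtain q r N where q: "q \<in> polyfams" "r \<in> polyfams"
    "\<And>c. smult (coeff (L c) m ^ N) (F c) = q c * L c + r c" "\<And>c j. j \<ge> m \<Longrightarrow> coeff (r c) j = 0"
    using polyfams_pseudo_divide[OF L(1,3) F(1)] by blast
  have "r c = 0" for c
  proof (rule ccontr)
    assume "r c \<noteq> 0"
    have "L c \<noteq> 0" using L(4)[of c] v by auto
    then have "L c dvd F c" by (intro dvd[of _ c v]) (auto simp: L F)
    then have "L c dvd q c * L c + r c" by (simp flip: q(3) add: dvd_smult)
    then have "L c dvd r c" by (simp add: dvd_add_right_iff)
    then have "degree (L c) \<le> degree (r c)"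
      using \<open>r c \<noteq> 0\<close> by (rule dvd_imp_degree_le)
    moreover have "degree (L c) \<ge> m" using L(4)[of c] v by (intro le_degree) auto
    ultimately show False
      using q(4)[of "degree (r c)" c] \<open>r c \<noteq> 0\<close> by auto
  qed
  then have "h v ^ N * f c = poly (q c) 0 * l c" for c
    using arg_cong[OF q(3)[of c], of "\<lambda>p. poly p 0"] by (simp add: L F)
  then have "f c = (1 / h v ^ N * poly (q c) 0) * l c" for c
    using v by (simp add: field_simps)
  then show ?thesis
    using q(1) by (intro bexI[of _ "\<lambda>c. 1 / h v ^ N * poly (q c) 0"] allI)
      (rule polyfuns_mult polyfams_poly polyfuns_const | assumption)+
qed

text \<open>A monic \<open>P\<close> has content 1, so the contents of \<open>Q\<close> and
  \<open>S\<close> multiply to \<open>l ^ N\<close> up to a unit. The content of \<open>Q\<close>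
  divides its leading coefficient, whose product with \<open>l\<close> is \<open>l ^ N\<close>;
  cancelling \<open>l ^ N\<close> shows that \<open>l\<close> divides the content of
  \<open>S\<close>.\<close>

lemma lead_coeff_dvd_coeff_of_monic_multiple:
  fixes P Q S :: "'a :: {factorial_ring_gcd, normalization_semidom_multiplicative} poly"
  assumes eq: "smult (l ^ N) P = Q * S" and P: "degree P \<le> D" "coeff P D = 1"
    and l: "lead_coeff S = l"
  shows "l dvd coeff S j"
proof (cases "l = 0")
  case True
  then show ?thesis using l by simp
next
  case False
  have "degree P = D" using P by (intro antisym le_degree) auto
  then have "lead_coeff Q * l = l ^ N"
    using arg_cong[OF eq, of lead_coeff] P l False by (simp add: lead_coeff_mult)
  have "content P dvd 1" using content_dvd_coeff[of P D] P by simp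
  then have "content P = 1"
    by (metis is_unit_normalize normalize_content)
  then have "content Q * content S = normalize (l ^ N)"
    using arg_cong[OF eq, of content] by (simp add: content_mult)
  then have "l ^ N dvd content Q * content S" by simp
  also have "\<dots> dvd lead_coeff Q * content S" by (intro mult_dvd_mono) auto
  finally have "l ^ N * l dvd lead_coeff Q * content S * l" by (intro mult_dvd_mono) auto
  also have "\<dots> = l ^ N * content S"
    using \<open>lead_coeff Q * l = l ^ N\<close> by (simp add: mult_ac)
  finally have "l dvd content S" using False by simp
  then show ?thesis using content_dvd_coeff dvd_trans by blast
qed

text \<open>On a line a family becomes a polynomial over the factorial ring of polynomials in
  \<open>s\<close>, where contents exist.\<close>

lemma polyfams_line:
  assumes "p \<in> polyfams"
  shows "\<exists>P :: complex poly poly. \<forall>s j. poly (coeff P j) s = coeff (p (\<lambda>w. c w + s * v w)) j"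
proof -
  obtain k where k: "\<And>c. degree (p c) \<le> k"
    using polyfams_degree_bound[OF assms] by auto
  have "\<exists>a. poly a = (\<lambda>s. coeff (p (\<lambda>w. c w + s * v w)) j)" for j
    using polyfuns_line[OF polyfams_coeff[OF assms]] by (metis (no_types, lifting) imageE)
  then obtain a where a: "\<And>j. poly (a j) = (\<lambda>s. coeff (p (\<lambda>w. c w + s * v w)) j)"
    by metis
  have "poly (coeff (\<Sum>i\<le>k. monom (a i) i) j) s = coeff (p (\<lambda>w. c w + s * v w)) j" for s j
  proof (cases "j \<le> k")
    case True
    then show ?thesis by (simp add: coeff_sum_monom a)
  next
    case False
    then have "coeff (p (\<lambda>w. c w + s * v w)) j = 0"
      by (intro coeff_eq_0 le_less_trans[OF k]) simp
    moreover have "coeff (\<Sum>i\<le>k. monom (a i) i) j = 0"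
      using False by (simp add: coeff_sum)
    ultimately show ?thesis by simp
  qed
  then show ?thesis by blast
qed

text \<open>Gauss's lemma over the ring of polynomial functions, reduced to the factorial ring
  \<open>\<complex>[s]\<close> by restriction to lines.\<close>

lemma polyfams_lead_coeff_dvd:
  assumes S: "S \<in> polyfams" "\<And>c. degree (S c) \<le> e" "coeff (S y) e \<noteq> 0"
    and q: "q \<in> polyfams"
    and p: "p \<in> polyfams" "\<And>c. degree (p c) \<le> D" "\<And>c. coeff (p c) D = 1"
    and eq: "\<And>c. smult (coeff (S c) e ^ N) (p c) = q c * S c"
  shows "\<exists>r\<in>polyfuns. \<forall>c. coeff (S c) j = r c * coeff (S c) e"
proof -
  have "a dvd b" if ab: "poly a = (\<lambda>s. coeff (S (\<lambda>w. c w + s * v w)) e)"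
    "poly b = (\<lambda>s. coeff (S (\<lambda>w. c w + s * v w)) j)" "a \<noteq> 0" for c v a b
  proof -
    let ?c = "\<lambda>s w. c w + s * v w"
    obtain P where P: "\<And>s j. poly (coeff P j) s = coeff (p (?c s)) j"
      using polyfams_line[OF p(1)] by blast
    obtain Q where Q: "\<And>s j. poly (coeff Q j) s = coeff (q (?c s)) j"
      using polyfams_line[OF q] by blast
    obtain T where T: "\<And>s j. poly (coeff T j) s = coeff (S (?c s)) j"
      using polyfams_line[OF S(1)] by blast
    have a: "coeff T e = a" and b: "coeff T j = b"
      by (simp_all add: poly_eq_poly_eq_iff[symmetric] fun_eq_iff T ab)
    have "smult (a ^ N) P = Q * T"
    proof (rule poly_eqI)
      fix i
      have "poly (coeff (smult (a ^ N) P) i) s = poly (coeff (Q * T) i) s" for s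
        using arg_cong[OF eq[of "?c s"], of "\<lambda>p. coeff p i"]
        by (simp add: coeff_mult poly_sum P Q T ab)
      then show "coeff (smult (a ^ N) P) i = coeff (Q * T) i"
        by (simp add: poly_eq_poly_eq_iff[symmetric] fun_eq_iff)
    qed
    moreover have "coeff P i = 0" if "i > D" for i
      using le_less_trans[OF p(2) that] by (simp add: poly_eq_poly_eq_iff[symmetric] fun_eq_iff P coeff_eq_0)
    then have "degree P \<le> D" by (intro degree_le) auto
    moreover have "coeff P D = 1"
      by (simp add: poly_eq_poly_eq_iff[symmetric] fun_eq_iff P p)
    moreover have "coeff T i = 0" if "i > e" for i
      using le_less_trans[OF S(2) that] by (simp add: poly_eq_poly_eq_iff[symmetric] fun_eq_iff T coeff_eq_0)
    then have "degree T = e"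
      using a ab(3) by (intro antisym degree_le le_degree) auto
    ultimately show ?thesis
      using lead_coeff_dvd_coeff_of_monic_multiple[of a N P Q T D j] a b by simp
  qed
  then show ?thesis
    by (intro polyfuns_dvd_of_lines[of "\<lambda>c. coeff (S c) e" y "\<lambda>c. coeff (S c) j"]
        polyfams_coeff S)
qed

section \<open>Irreducible hypersurfaces\<close>

text \<open>A polynomial function \<open>f\<close> is studied through \<open>t \<mapsto> f (c + t G)\<close>. Among the families vanishing
  on \<open>{(c, t). c + t G \<in> Z}\<close> one of minimal degree in \<open>t\<close> divides \<open>p\<^sub>0\<close> up to a power of its leading
  coefficient, so by Gauss's lemma it can be made monic, and then it divides all the others.\<close>

lemma vanishing_ideal_principal:
  fixes Z :: "('v \<Rightarrow> complex) set" and G :: "'v \<Rightarrow> complex"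
  assumes prime: "\<And>f g. f \<in> polyfuns \<Longrightarrow> g \<in> polyfuns \<Longrightarrow> \<forall>c\<in>Z. f c * g c = 0 \<Longrightarrow>
      (\<forall>c\<in>Z. f c = 0) \<or> (\<forall>c\<in>Z. g c = 0)"
    and dense: "\<And>f x. f \<in> polyfuns \<Longrightarrow> (\<And>c t. (\<lambda>v. c v + t * G v) \<in> Z \<Longrightarrow> f c = 0) \<Longrightarrow> f x = 0"
    and p0: "p0 \<in> polyfams" "\<And>c. degree (p0 c) \<le> D" "\<And>c. coeff (p0 c) D = 1"
      "\<And>c t. (\<lambda>v. c v + t * G v) \<in> Z \<Longrightarrow> poly (p0 c) t = 0"
  obtains R where "R \<in> polyfuns" "\<And>c. c \<in> Z \<Longrightarrow> R c = 0"
    "\<And>f. f \<in> polyfuns \<Longrightarrow> \<forall>c\<in>Z. f c = 0 \<Longrightarrow> \<exists>q\<in>polyfuns. \<forall>c. f c = q c * R c"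
proof -
  define shift where "shift c t = (\<lambda>v. c v + t * G v)" for c t
  have shift_shift [simp]: "shift (shift c t) (- t) = c" "shift (shift c (- t)) t = c" "shift c 0 = c" for c t
    by (simp_all add: shift_def)
  have curve: "(\<lambda>t. f (shift c (- t))) \<in> range poly" if "f \<in> polyfuns" for f c
    unfolding shift_def using that
    by (rule polyfuns_curve) (intro range_poly_add range_poly_mult range_poly_const
        range_poly_diff[of "\<lambda>_. 0", simplified] range_poly_id)
  define I where "I = {p \<in> polyfams. \<forall>c t. shift c t \<in> Z \<longrightarrow> poly (p c) t = 0}"
  \<comment> \<open>Here \<open>e\<close> is a formal degree: its coefficient is nonzero somewhere
    but may vanish at special \<open>c\<close>.\<close>
  define good where "good e \<longleftrightarrow> (\<exists>S\<in>I. (\<forall>c. degree (S c) \<le> e) \<and> (\<exists>c. coeff (S c) e \<noteq> 0))" for e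
  have "p0 \<in> I" using p0 by (auto simp: I_def shift_def)
  then have "good D" using p0 unfolding good_def by fastforce
  define e where "e = (LEAST e. good e)"
  have "good e" unfolding e_def using \<open>good D\<close> by (rule LeastI)
  then obtain S y where S: "S \<in> I" "\<And>c. degree (S c) \<le> e" "coeff (S y) e \<noteq> 0"
    unfolding good_def by blast
  have minimal: "r c = 0" if r: "r \<in> I" "\<forall>c. \<forall>j\<ge>e. coeff (r c) j = 0" for r c
  proof (rule ccontr)
    assume "r c \<noteq> 0"
    let ?P = "\<lambda>j. \<exists>c. coeff (r c) j \<noteq> 0"
    define k where "k = (GREATEST j. ?P j)"
    have ex: "?P (degree (r c))" using \<open>r c \<noteq> 0\<close> by (intro exI[of _ c]) simp
    have bound: "j \<le> e" if "?P j" for j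
      using that r(2) by (metis nle_le)
    have "?P k" unfolding k_def using ex bound by (rule GreatestI_nat)
    moreover have "j \<le> k" if "?P j" for j
      unfolding k_def using that bound by (rule Greatest_le_nat)
    then have "degree (r c) \<le> k" for c
      by (metis degree_0 leading_coeff_0_iff zero_le)
    ultimately have "good k" using r(1) unfolding good_def by blast
    then have "e \<le> k" unfolding e_def by (rule Least_le)
    with \<open>?P k\<close> r(2) show False by auto
  qed
  obtain N q r where q: "q \<in> polyfams" "r \<in> polyfams"
    and div: "\<forall>c. smult (coeff (S c) e ^ N) (p0 c) = q c * S c + r c" "\<forall>c. \<forall>j\<ge>e. coeff (r c) j = 0"
    using polyfams_pseudo_divide[of S e p0] S p0(1) by (auto simp: I_def)
  have "poly (r c) t = 0" if "shift c t \<in> Z" for c t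
    using arg_cong[OF spec[OF div(1), of c], of "\<lambda>p. poly p t"] that S(1) \<open>p0 \<in> I\<close> by (simp add: I_def)
  with q have "r c = 0" for c
    using div(2) by (intro minimal) (auto simp: I_def)
  with div have eq: "smult (coeff (S c) e ^ N) (p0 c) = q c * S c" for c by simp
  have "S \<in> polyfams" using S by (simp add: I_def)
  have "\<exists>r\<in>polyfuns. \<forall>c. coeff (S c) j = r c * coeff (S c) e" for j
    using polyfams_lead_coeff_dvd[OF \<open>S \<in> polyfams\<close> S(2,3) q(1) p0(1,2,3) eq] .
  then obtain \<rho> where \<rho>: "\<And>j. \<rho> j \<in> polyfuns" "\<And>j c. coeff (S c) j = \<rho> j c * coeff (S c) e"
    by metis
  have \<rho>_e: "\<rho> e c = 1" for c
    by (rule polyfuns_mult_cancel[of "\<rho> e" "\<lambda>_. 1" "\<lambda>c. coeff (S c) e" y])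
      (simp_all add: \<rho>(1) polyfams_coeff \<open>S \<in> polyfams\<close> S flip: \<rho>(2))
  \<comment> \<open>\<open>T\<close> is \<open>S\<close> divided by its leading coefficient, hence
    monic. That it still lies in \<open>I\<close> needs an argument, since the leading coefficient
    may vanish on parts of the zero set.\<close>
  define T where "T c = (\<Sum>j\<le>e. monom (\<rho> j c) j)" for c
  have T: "T \<in> polyfams"
    unfolding T_def by (intro polyfams_sum polyfams_monom \<rho>)
  have T_deg: "degree (T c) \<le> e" for c
    unfolding T_def by (intro degree_sum_le) (auto intro: order.trans[OF degree_monom_le])
  have T_e: "coeff (T c) e = 1" for c
    by (simp add: T_def coeff_sum_monom \<rho>_e)
  have T_S: "smult (coeff (S c) e) (T c) = S c" for c
  proof (rule poly_eqI)
    fix j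
    show "coeff (smult (coeff (S c) e) (T c)) j = coeff (S c) j"
    proof (cases "j \<le> e")
      case True
      then show ?thesis using \<rho>(2)[of c j] by (simp add: T_def coeff_sum_monom)
    next
      case False
      then show ?thesis using S(2)[of c] T_deg[of c] by (simp add: coeff_eq_0)
    qed
  qed
  have "T \<in> I"
  proof -
    \<comment> \<open>For fixed \<open>t\<close>, primeness applies to the two factors of
      \<open>poly (S c) t\<close> at \<open>c = shift z (- t)\<close>. One alternative holds for
      infinitely many \<open>t\<close>, hence for all \<open>t\<close>, being polynomial in
      \<open>t\<close>. In the case of \<open>A\<close> the leading coefficient would vanish at
      every \<open>c\<close> whose line meets \<open>Z\<close>, so everywhere by
      \<open>dense\<close>.\<close>
    define A where "A = {t. \<forall>z\<in>Z. coeff (S (shift z (- t))) e = 0}"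
    define B where "B = {t. \<forall>z\<in>Z. poly (T (shift z (- t))) t = 0}"
    have "t \<in> A \<union> B" for t
    proof -
      have shifted: "(\<lambda>z. f (shift z (- t))) \<in> polyfuns" if "f \<in> polyfuns" for f
        unfolding shift_def using that
        by (rule polyfuns_compose) (intro polyfuns_add polyfuns_var polyfuns_const)
      have "poly (S (shift z (- t))) t = 0" if "z \<in> Z" for z
        using S(1) that by (simp add: I_def)
      then have "coeff (S (shift z (- t))) e * poly (T (shift z (- t))) t = 0" if "z \<in> Z" for z
        using that T_S by (metis poly_smult)
      then show ?thesis
        using prime[OF shifted[OF polyfams_coeff[OF \<open>S \<in> polyfams\<close>]] shifted[OF polyfams_poly[OF T]], of e t]
        by (auto simp: A_def B_def)
    qed
    then have "A \<union> B = UNIV" by auto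
    then have "infinite A \<or> infinite B"
      by (metis finite_Un infinite_UNIV_char_0)
    then show ?thesis
    proof
      assume "infinite A"
      have "coeff (S (shift z (- t))) e = 0" if "z \<in> Z" for z t
      proof (rule range_poly_eq_zero[where f = "\<lambda>t. coeff (S (shift z (- t))) e"])
        show "infinite {t. coeff (S (shift z (- t))) e = 0}"
          using that \<open>infinite A\<close> by (auto simp: A_def elim!: infinite_super[rotated])
      qed (rule curve[OF polyfams_coeff[OF \<open>S \<in> polyfams\<close>]])
      then have "coeff (S c) e = 0" if "shift c t \<in> Z" for c t
        using that by (metis shift_shift(1))
      then have "coeff (S y) e = 0"
        using dense[of "\<lambda>c. coeff (S c) e" y] polyfams_coeff[OF \<open>S \<in> polyfams\<close>, of e]
        unfolding shift_def by blast
      with S(3) show ?thesis by simp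
    next
      assume "infinite B"
      have "poly (T (shift z (- t))) t = 0" if "z \<in> Z" for z t
      proof (rule range_poly_eq_zero[where f = "\<lambda>t. poly (T (shift z (- t))) t"])
        show "infinite {t. poly (T (shift z (- t))) t = 0}"
          using that \<open>infinite B\<close> by (auto simp: B_def elim!: infinite_super[rotated])
        have "(\<lambda>t. poly (T (shift z (- t))) t) = (\<lambda>t. \<Sum>j\<le>e. coeff (T (shift z (- t))) j * t ^ j)"
          using T_deg by (auto simp: poly_bounded_sum)
        moreover have "\<dots> \<in> range poly"
          by (intro range_poly_sum range_poly_mult range_poly_power range_poly_id
              curve[OF polyfams_coeff[OF T]])
        ultimately show "(\<lambda>t. poly (T (shift z (- t))) t) \<in> range poly" by simp
      qed
      then have "poly (T c) t = 0" if "shift c t \<in> Z" for c t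
        using that by (metis shift_shift(1))
      with T show ?thesis by (simp add: I_def)
    qed
  qed
  show ?thesis
  \<comment> \<open>At \<open>t = 0\<close> the line returns to its base point:
    \<open>poly (F c) 0 = f c\<close>. Since \<open>T\<close> is monic, pseudo-division by it is
    division.\<close>
  proof (rule that[of "\<lambda>c. poly (T c) 0"])
    show "(\<lambda>c. poly (T c) 0) \<in> polyfuns" using T by (rule polyfams_poly)
    show "poly (T c) 0 = 0" if "c \<in> Z" for c
      using \<open>T \<in> I\<close> that unfolding I_def by (metis (mono_tags, lifting) mem_Collect_eq shift_shift(3))
  next
    fix f assume f: "f \<in> polyfuns" "\<forall>c\<in>Z. f c = 0"
    obtain F where F: "F \<in> polyfams" "\<And>c t. poly (F c) t = f (shift c t)"
      unfolding shift_def using polyfams_expand[OF f(1)] by blast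
    obtain M u w where u: "u \<in> polyfams" "w \<in> polyfams"
      and div: "\<forall>c. smult (coeff (T c) e ^ M) (F c) = u c * T c + w c" "\<forall>c. \<forall>j\<ge>e. coeff (w c) j = 0"
      using polyfams_pseudo_divide[OF T T_deg F(1)] by blast
    have "poly (w c) t = 0" if "shift c t \<in> Z" for c t
      using arg_cong[OF spec[OF div(1), of c], of "\<lambda>p. poly p t"] that f \<open>T \<in> I\<close>
      by (simp add: I_def T_e F)
    then have "w c = 0" for c
      using u div(2) by (intro minimal) (auto simp: I_def)
    then have "f c = poly (u c) 0 * poly (T c) 0" for c
      using arg_cong[OF spec[OF div(1), of c], of "\<lambda>p. poly p 0"] by (simp add: T_e F)
    then show "\<exists>q\<in>polyfuns. \<forall>c. f c = q c * poly (T c) 0"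
      using polyfams_poly[OF u(1), of 0] by (intro bexI[of _ "\<lambda>c. poly (u c) 0"]) simp_all
  qed
qed

section \<open>Systems of forms without nontrivial zero\<close>

text \<open>Gaussian elimination: a pivot removes the equation \<open>p\<close> together with the
  unknown \<open>q\<close>, which preserves the inequality of cardinalities.\<close>

lemma homogeneous_linear_system_solvable:
  fixes \<gamma> :: "'a \<Rightarrow> 'b \<Rightarrow> 'c :: field"
  assumes "finite B" "finite A" "card B < card A"
  shows "\<exists>c. (\<exists>a\<in>A. c a \<noteq> 0) \<and> (\<forall>b\<in>B. (\<Sum>a\<in>A. c a * \<gamma> a b) = 0)"
  using assms
proof (induction B arbitrary: A \<gamma> rule: finite_induct)
  case empty
  then have "A \<noteq> {}" by auto
  then show ?case by (intro exI[of _ "\<lambda>_. 1"]) auto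
next
  case (insert p B)
  show ?case
  proof (cases "\<forall>a\<in>A. \<gamma> a p = 0")
    case True
    moreover obtain c where "\<exists>a\<in>A. c a \<noteq> 0" "\<forall>b\<in>B. (\<Sum>a\<in>A. c a * \<gamma> a b) = 0"
      using insert.IH[of A \<gamma>] insert.prems insert.hyps by auto
    ultimately show ?thesis by (intro exI[of _ c]) auto
  next
    case False
    then obtain q where q: "q \<in> A" "\<gamma> q p \<noteq> 0" by auto
    define \<gamma>' where "\<gamma>' a b = \<gamma> a b - \<gamma> a p / \<gamma> q p * \<gamma> q b" for a b
    have "card B < card (A - {q})" using q insert.prems insert.hyps by simp
    then obtain c where c: "\<exists>a\<in>A - {q}. c a \<noteq> 0" "\<forall>b\<in>B. (\<Sum>a\<in>A - {q}. c a * \<gamma>' a b) = 0"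
      using insert.IH[of "A - {q}" \<gamma>'] insert.prems by auto
    define c' where "c' = c(q := - (\<Sum>a\<in>A - {q}. c a * (\<gamma> a p / \<gamma> q p)))"
    have sum: "(\<Sum>a\<in>A. c' a * \<gamma> a b) = (\<Sum>a\<in>A - {q}. c a * \<gamma>' a b)" for b
    proof -
      have "(\<Sum>a\<in>A. c' a * \<gamma> a b) = c' q * \<gamma> q b + (\<Sum>a\<in>A - {q}. c' a * \<gamma> a b)"
        using q insert.prems by (intro sum.remove) auto
      also have "(\<Sum>a\<in>A - {q}. c' a * \<gamma> a b) = (\<Sum>a\<in>A - {q}. c a * \<gamma> a b)"
        by (intro sum.cong) (auto simp: c'_def)
      finally show ?thesis
        by (simp add: c'_def \<gamma>'_def sum_distrib_right sum_subtractf right_diff_distrib mult.assoc)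
    qed
    have "(\<Sum>a\<in>A - {q}. c a * \<gamma>' a p) = 0" using q by (simp add: \<gamma>'_def)
    then have "\<forall>b\<in>insert p B. (\<Sum>a\<in>A. c' a * \<gamma> a b) = 0" using c sum by auto
    moreover have "\<exists>a\<in>A. c' a \<noteq> 0" using c(1) by (auto simp: c'_def)
    ultimately show ?thesis by blast
  qed
qed

section \<open>Degrees of monomials\<close>

lemma monom_degree_superset:
  assumes "finite V" "Poly_Mapping.keys a \<subseteq> V"
  shows "monom_degree a = (\<Sum>v\<in>V. Poly_Mapping.lookup a v)"
  unfolding monom_degree_def using assms
  by (intro sum.mono_neutral_left) (auto simp: in_keys_iff)

lemma monom_degree_UNIV: "monom_degree (a :: 'n::finite \<Rightarrow>\<^sub>0 nat) = (\<Sum>i\<in>UNIV. Poly_Mapping.lookup a i)"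
  by (rule monom_degree_superset) auto

lemma monom_degree_add: "monom_degree (a + b) = monom_degree a + monom_degree b"
proof -
  let ?V = "Poly_Mapping.keys a \<union> Poly_Mapping.keys b"
  have "monom_degree (a + b) = (\<Sum>v\<in>?V. Poly_Mapping.lookup (a + b) v)"
    by (intro monom_degree_superset) (auto simp: Poly_Mapping.keys_add)
  moreover have "monom_degree a = (\<Sum>v\<in>?V. Poly_Mapping.lookup a v)"
    "monom_degree b = (\<Sum>v\<in>?V. Poly_Mapping.lookup b v)"
    by (intro monom_degree_superset; auto)+
  ultimately show ?thesis by (simp add: lookup_add sum.distrib)
qed

lemma monom_degree_zero [simp]: "monom_degree 0 = 0"
  by (simp add: monom_degree_def)

lemma monom_degree_single [simp]: "monom_degree (Poly_Mapping.single v k) = k"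
  by (cases "k = 0") (simp_all add: monom_degree_def)

lemma finite_monom_degree_le: "finite {a :: 'n::finite \<Rightarrow>\<^sub>0 nat. monom_degree a \<le> D}"
proof (rule finite_imageD)
  have "Poly_Mapping.lookup a i \<le> monom_degree a" for a :: "'n \<Rightarrow>\<^sub>0 nat" and i
    unfolding monom_degree_UNIV by (rule member_le_sum) auto
  then have "Poly_Mapping.lookup ` {a :: 'n \<Rightarrow>\<^sub>0 nat. monom_degree a \<le> D} \<subseteq> (\<Pi>\<^sub>E i\<in>UNIV. {..D})"
    by (auto intro: order.trans)
  then show "finite (Poly_Mapping.lookup ` {a :: 'n \<Rightarrow>\<^sub>0 nat. monom_degree a \<le> D})"
    by (rule finite_subset) (auto intro: finite_PiE)
  show "inj_on Poly_Mapping.lookup {a :: 'n \<Rightarrow>\<^sub>0 nat. monom_degree a \<le> D}"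
    by (auto intro: inj_onI poly_mapping_eqI)
qed

subsection \<open>The Nullstellensatz\<close>

definition poly_ideal :: "(('v \<Rightarrow> complex) \<Rightarrow> complex) set \<Rightarrow> bool" where
  "poly_ideal M \<longleftrightarrow> M \<subseteq> polyfuns \<and> (\<lambda>x. 0) \<in> M \<and> (\<forall>f\<in>M. \<forall>g\<in>M. (\<lambda>x. f x + g x) \<in> M) \<and>
     (\<forall>f\<in>M. \<forall>h\<in>polyfuns. (\<lambda>x. h x * f x) \<in> M)"

lemma poly_ideal_zero: "poly_ideal M \<Longrightarrow> (\<lambda>x. 0) \<in> M"
  by (simp add: poly_ideal_def)

lemma poly_ideal_add: "poly_ideal M \<Longrightarrow> f \<in> M \<Longrightarrow> g \<in> M \<Longrightarrow> (\<lambda>x. f x + g x) \<in> M"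
  by (simp add: poly_ideal_def)

lemma poly_ideal_mult: "poly_ideal M \<Longrightarrow> f \<in> M \<Longrightarrow> h \<in> polyfuns \<Longrightarrow> (\<lambda>x. h x * f x) \<in> M"
  by (simp add: poly_ideal_def)

lemma poly_ideal_polyfuns: "poly_ideal M \<Longrightarrow> f \<in> M \<Longrightarrow> f \<in> polyfuns"
  by (auto simp: poly_ideal_def)

lemma poly_ideal_sum:
  "poly_ideal M \<Longrightarrow> (\<And>i. i \<in> I \<Longrightarrow> f i \<in> M) \<Longrightarrow> (\<lambda>x. \<Sum>i\<in>I. f i x) \<in> M"
  by (induction I rule: infinite_finite_induct) (simp_all add: poly_ideal_zero poly_ideal_add)

text \<open>\<open>M'\<close> is the ideal generated by \<open>M\<close> and \<open>f\<close>, the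
  competitor against which maximality of \<open>M\<close> is tested.\<close>

lemma poly_ideal_extend:
  fixes M :: "(('v \<Rightarrow> complex) \<Rightarrow> complex) set"
  assumes "poly_ideal M" "f \<in> polyfuns"
  defines "M' \<equiv> {h. \<exists>g\<in>polyfuns. \<exists>m\<in>M. h = (\<lambda>x. g x * f x + m x)}"
  shows "poly_ideal M'" "M \<subseteq> M'" "f \<in> M'"
proof -
  have M'I: "h \<in> M'" if "g \<in> polyfuns" "m \<in> M" "h = (\<lambda>x. g x * f x + m x)" for g m h
    using that by (auto simp: M'_def)
  show "poly_ideal M'"
    unfolding poly_ideal_def
  proof (intro conjI ballI)
    show "M' \<subseteq> polyfuns"
      using assms by (auto simp: M'_def intro!: polyfuns_add polyfuns_mult dest: poly_ideal_polyfuns)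
    show "(\<lambda>x. 0) \<in> M'"
      by (rule M'I[of "\<lambda>_. 0" "\<lambda>_. 0"]) (simp_all add: poly_ideal_zero[OF assms(1)])
  next
    fix h1 h2 assume "h1 \<in> M'" "h2 \<in> M'"
    then obtain g1 m1 g2 m2 where "g1 \<in> polyfuns" "g2 \<in> polyfuns" "m1 \<in> M" "m2 \<in> M"
      "h1 = (\<lambda>x. g1 x * f x + m1 x)" "h2 = (\<lambda>x. g2 x * f x + m2 x)"
      by (auto simp: M'_def)
    then show "(\<lambda>x. h1 x + h2 x) \<in> M'"
      by (intro M'I[OF polyfuns_add[of g1 g2] poly_ideal_add[OF assms(1), of m1 m2]])
        (simp_all add: algebra_simps)
  next
    fix h u :: "('v \<Rightarrow> complex) \<Rightarrow> complex" assume "h \<in> M'" and u: "u \<in> polyfuns"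
    then obtain g m where "g \<in> polyfuns" "m \<in> M" "h = (\<lambda>x. g x * f x + m x)"
      by (auto simp: M'_def)
    with u show "(\<lambda>x. u x * h x) \<in> M'"
      by (intro M'I[OF polyfuns_mult[of u g] poly_ideal_mult[OF assms(1), of m u]])
        (simp_all add: algebra_simps)
  qed
  show "M \<subseteq> M'"
    using M'I[of "\<lambda>_. 0"] by auto
  show "f \<in> M'"
    by (rule M'I[of "\<lambda>_. 1" "\<lambda>_. 0"]) (simp_all add: poly_ideal_zero[OF assms(1)])
qed

text \<open>An ideal that is maximal among those without powers of \<open>x\<^sub>i\<close> is prime. If it contained no
  \<open>x\<^sub>j - \<mu>\<close>, then every \<open>\<mu>\<close> would give a polynomial \<open>g\<^sub>\<mu>\<close> that inverts \<open>x\<^sub>j - \<mu>\<close> up to a power of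
  \<open>x\<^sub>i\<close>. As \<open>\<complex>\<close> is uncountable, infinitely many of these have the same exponent and the same degree
  bound, hence are linearly dependent, and clearing denominators puts a polynomial in \<open>x\<^sub>j\<close> alone
  into the ideal.\<close>

lemma nullstellensatz:
  fixes J :: "(('n::finite \<Rightarrow> complex) \<Rightarrow> complex) set"
  assumes J: "poly_ideal J" and powers: "\<And>k. (\<lambda>x. x i ^ k) \<notin> J"
  shows "\<exists>x. x i \<noteq> 0 \<and> (\<forall>f\<in>J. f x = 0)"
proof -
  define \<A> where "\<A> = {M. poly_ideal M \<and> J \<subseteq> M \<and> (\<forall>k. (\<lambda>x. x i ^ k) \<notin> M)}"
  have "\<exists>M\<in>\<A>. \<forall>X\<in>\<A>. M \<subseteq> X \<longrightarrow> X = M"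
  proof (rule subset_Zorn_nonempty)
    show "\<A> \<noteq> {}" using J powers by (auto simp: \<A>_def)
    fix \<C> assume "\<C> \<noteq> {}" "subset.chain \<A> \<C>"
    then have C: "poly_ideal M" "J \<subseteq> M" "(\<lambda>x. x i ^ k) \<notin> M" if "M \<in> \<C>" for M k
      using that by (auto simp: subset.chain_def \<A>_def)
    have chain: "M \<subseteq> M' \<or> M' \<subseteq> M" if "M \<in> \<C>" "M' \<in> \<C>" for M M'
      using \<open>subset.chain \<A> \<C>\<close> that by (auto simp: subset.chain_def)
    have "poly_ideal (\<Union>\<C>)"
      unfolding poly_ideal_def
    proof (intro conjI ballI)
      show "\<Union>\<C> \<subseteq> polyfuns"
        using C(1) poly_ideal_polyfuns by blast
      show "(\<lambda>x. 0) \<in> \<Union>\<C>"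
        using C(1) poly_ideal_zero \<open>\<C> \<noteq> {}\<close> by blast
      fix f assume "f \<in> \<Union>\<C>"
      then obtain M where M: "f \<in> M" "M \<in> \<C>" by auto
      then show "(\<lambda>x. h x * f x) \<in> \<Union>\<C>" if "h \<in> polyfuns" for h
        using poly_ideal_mult[OF C(1), of M f h] that by blast
      fix g assume "g \<in> \<Union>\<C>"
      then obtain M' where M': "g \<in> M'" "M' \<in> \<C>" by auto
      obtain M'' where "f \<in> M''" "g \<in> M''" "M'' \<in> \<C>"
        using chain[of M M'] M M' by auto
      then show "(\<lambda>x. f x + g x) \<in> \<Union>\<C>"
        using poly_ideal_add[OF C(1), of M'' f g] by blast
    qed
    then show "\<Union>\<C> \<in> \<A>"
      using C(2,3) \<open>\<C> \<noteq> {}\<close> unfolding \<A>_def by blast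
  qed
  then obtain M where "M \<in> \<A>" and maximal: "\<And>X. X \<in> \<A> \<Longrightarrow> M \<subseteq> X \<Longrightarrow> X = M"
    by blast
  then have M: "poly_ideal M" "J \<subseteq> M" "\<And>k. (\<lambda>x. x i ^ k) \<notin> M"
    by (auto simp: \<A>_def)
  \<comment> \<open>Adjoining \<open>f\<close> to \<open>M\<close> leaves \<open>\<A>\<close>, so a
    power of \<open>x i\<close> appears: every polynomial function outside \<open>M\<close> is
    invertible modulo \<open>M\<close> up to such a power.\<close>
  have extend: "\<exists>k. \<exists>g\<in>polyfuns. \<exists>m\<in>M. \<forall>x. x i ^ k = g x * f x + m x"
    if f: "f \<in> polyfuns" "f \<notin> M" for f
  proof -
    define M' where "M' = {h. \<exists>g\<in>polyfuns. \<exists>m\<in>M. h = (\<lambda>x. g x * f x + m x)}"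
    note M' = poly_ideal_extend[OF M(1) f(1), folded M'_def]
    have "M' \<notin> \<A>" using maximal[of M'] M' f by auto
    with M' M(2) obtain k where "(\<lambda>x. x i ^ k) \<in> M'" by (auto simp: \<A>_def)
    then show ?thesis by (auto simp: M'_def fun_eq_iff)
  qed
  have prime: "f \<in> M \<or> g \<in> M"
    if fg: "f \<in> polyfuns" "g \<in> polyfuns" "(\<lambda>x. f x * g x) \<in> M" for f g
  proof (rule ccontr)
    assume "\<not> (f \<in> M \<or> g \<in> M)"
    then have "f \<notin> M" "g \<notin> M" by auto
    obtain k u m where u: "u \<in> polyfuns" "m \<in> M" "\<And>x. x i ^ k = u x * f x + m x"
      using extend[OF fg(1) \<open>f \<notin> M\<close>] by blast
    obtain l v n where v: "v \<in> polyfuns" "n \<in> M" "\<And>x. x i ^ l = v x * g x + n x"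
      using extend[OF fg(2) \<open>g \<notin> M\<close>] by blast
    have "(\<lambda>x. x i ^ (k + l)) = (\<lambda>x. (u x * v x) * (f x * g x) + ((x i ^ l) * m x + (u x * f x) * n x))"
    proof
      fix x
      have "x i ^ (k + l) = (u x * f x + m x) * x i ^ l" by (simp only: power_add u(3))
      also have "\<dots> = (u x * f x) * (v x * g x + n x) + x i ^ l * m x"
        by (simp only: v(3)[symmetric]) (simp add: algebra_simps)
      finally show "x i ^ (k + l) = (u x * v x) * (f x * g x) + ((x i ^ l) * m x + (u x * f x) * n x)"
        by (simp add: algebra_simps)
    qed
    also have "\<dots> \<in> M"
    proof (intro poly_ideal_add[OF M(1)])
      show "(\<lambda>x. (u x * v x) * (f x * g x)) \<in> M"
        using u(1) v(1) by (intro poly_ideal_mult[OF M(1) fg(3)] polyfuns_mult)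
      show "(\<lambda>x. (x i ^ l) * m x) \<in> M"
        by (intro poly_ideal_mult[OF M(1) u(2)] polyfuns_power polyfuns_var)
      show "(\<lambda>x. (u x * f x) * n x) \<in> M"
        using u(1) fg(1) by (intro poly_ideal_mult[OF M(1) v(2)] polyfuns_mult)
    qed
    finally show False using M(3) by blast
  qed
  have const: "a = 0" if "(\<lambda>x. a) \<in> M" for a
  proof (rule ccontr)
    assume "a \<noteq> 0"
    then have "(\<lambda>x. x i ^ 0) \<in> M"
      using poly_ideal_mult[OF M(1) that polyfuns_const[of "1 / a"]] by simp
    with M(3) show False by blast
  qed
  have linear: "(\<lambda>x. x j - \<mu>) \<in> polyfuns" for j :: 'n and \<mu>
    by (intro polyfuns_diff polyfuns_var polyfuns_const)
  have linear_factor: "\<exists>\<mu>. (\<lambda>x. x j - \<mu>) \<in> M"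
    if "q \<noteq> 0" "(\<lambda>x. poly q (x j)) \<in> M" for q j
    using that
  proof (induction "degree q" arbitrary: q rule: less_induct)
    case less
    have "\<not> constant (poly q)"
    proof
      assume "constant (poly q)"
      then obtain a where a: "poly q = (\<lambda>_. a)" unfolding constant_def by (metis (mono_tags) ext)
      with less.prems(2) have "a = 0" by (simp add: const)
      with a less.prems(1) show False
        by (metis poly_0 poly_eq_poly_eq_iff ext)
    qed
    then obtain \<mu> where "poly q \<mu> = 0" using fundamental_theorem_of_algebra by blast
    then obtain q' where q': "q = [:-\<mu>, 1:] * q'" by (meson poly_eq_0_iff_dvd dvdE)
    have "(\<lambda>x. (x j - \<mu>) * poly q' (x j)) \<in> M"
      using less.prems(2) unfolding q' by (simp add: algebra_simps)
    moreover have "(\<lambda>x. poly q' (x j)) \<in> polyfuns"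
      unfolding poly_altdef
      by (intro polyfuns_sum polyfuns_mult polyfuns_power polyfuns_const polyfuns_var)
    ultimately consider "(\<lambda>x. x j - \<mu>) \<in> M" | "(\<lambda>x. poly q' (x j)) \<in> M"
      using prime[OF linear[of j \<mu>], of "\<lambda>x. poly q' (x j)"] by blast
    then show ?case
    proof cases
      case 2
      have "q' \<noteq> 0" using less.prems(1) q' by auto
      moreover from this have "degree q' < degree q"
        unfolding q' by (subst degree_mult_eq) auto
      ultimately show ?thesis using less.hyps 2 by blast
    qed blast
  qed
  have "\<exists>\<mu>. (\<lambda>x. x j - \<mu>) \<in> M" for j
  proof (rule ccontr)
    assume "\<nexists>\<mu>. (\<lambda>x. x j - \<mu>) \<in> M"
    then have "\<exists>k. \<exists>g\<in>polyfuns. \<exists>m\<in>M. \<forall>x. x i ^ k = g x * (x j - \<mu>) + m x" for \<mu>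
      using extend[OF linear[of j \<mu>]] by blast
    then obtain k g m where g: "\<And>\<mu>. g \<mu> \<in> polyfuns" and m: "\<And>\<mu>. m \<mu> \<in> M"
      and inv: "\<And>\<mu> x. x i ^ k \<mu> = g \<mu> x * (x j - \<mu>) + m \<mu> x"
      by metis
    have "\<exists>D \<gamma>. g \<mu> = (\<lambda>x. \<Sum>a | monom_degree a \<le> D. \<gamma> a * monom_eval a x)" for \<mu>
    proof -
      from g[of \<mu>] obtain A \<kappa> where A: "finite A" "g \<mu> = (\<lambda>x. \<Sum>a\<in>A. \<kappa> a * monom_eval a x)"
        by (rule polyfuns_obtain)
      let ?D = "\<Sum>a\<in>A. monom_degree a"
      have "(\<Sum>a\<in>A. \<kappa> a * monom_eval a x)
          = (\<Sum>a | monom_degree a \<le> ?D. (if a \<in> A then \<kappa> a else 0) * monom_eval a x)" for x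
        using A(1) member_le_sum[of _ A monom_degree]
        by (intro sum.mono_neutral_cong_left) (auto simp: finite_monom_degree_le)
      then show ?thesis
        unfolding A(2) by (intro exI[of _ ?D] exI[of _ "\<lambda>a. if a \<in> A then \<kappa> a else 0"] ext)
    qed
    then obtain D \<gamma> where \<gamma>: "\<And>\<mu>. g \<mu> = (\<lambda>x. \<Sum>a | monom_degree a \<le> D \<mu>. \<gamma> \<mu> a * monom_eval a x)"
      by metis
    have "\<exists>p. infinite {\<mu>. (k \<mu>, D \<mu>) = p}"
    proof (rule ccontr)
      assume "\<nexists>p. infinite {\<mu>. (k \<mu>, D \<mu>) = p}"
      then have "countable (\<Union>p. {\<mu>. (k \<mu>, D \<mu>) = p})"
        by (intro countable_UN) (auto intro: countable_finite)
      moreover have "(\<Union>p. {\<mu>. (k \<mu>, D \<mu>) = p}) = UNIV" by auto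
      ultimately show False using uncountable_UNIV_complex by simp
    qed
    then obtain K E where "infinite {\<mu>. k \<mu> = K \<and> D \<mu> = E}" by auto
    \<comment> \<open>One element more than there are monomials, so the \<open>g \<mu>\<close> with
      \<open>\<mu> \<in> \<Lambda>\<close> are linearly dependent.\<close>
    then obtain \<Lambda> where \<Lambda>: "finite \<Lambda>" "card \<Lambda> = Suc (card {a :: 'n \<Rightarrow>\<^sub>0 nat. monom_degree a \<le> E})"
      "\<Lambda> \<subseteq> {\<mu>. k \<mu> = K \<and> D \<mu> = E}"
      using infinite_arbitrarily_large by blast
    obtain c w where c: "w \<in> \<Lambda>" "c w \<noteq> 0"
      "\<And>a. monom_degree a \<le> E \<Longrightarrow> (\<Sum>\<mu>\<in>\<Lambda>. c \<mu> * \<gamma> \<mu> a) = 0"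
      using homogeneous_linear_system_solvable[OF finite_monom_degree_le \<Lambda>(1), of E \<gamma>] \<Lambda>(2) by auto
    have dependent: "(\<Sum>\<mu>\<in>\<Lambda>. c \<mu> * g \<mu> x) = 0" for x
    proof -
      have "(\<Sum>\<mu>\<in>\<Lambda>. c \<mu> * g \<mu> x)
          = (\<Sum>\<mu>\<in>\<Lambda>. \<Sum>a | monom_degree a \<le> E. c \<mu> * \<gamma> \<mu> a * monom_eval a x)"
        using \<Lambda>(3) by (intro sum.cong) (auto simp: \<gamma> sum_distrib_left mult.assoc)
      also have "\<dots> = (\<Sum>a | monom_degree a \<le> E. (\<Sum>\<mu>\<in>\<Lambda>. c \<mu> * \<gamma> \<mu> a) * monom_eval a x)"
        by (subst sum.swap) (simp add: sum_distrib_right)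
      finally show ?thesis using c(3) by simp
    qed
    \<comment> \<open>The numerator of the sum of the fractions
      \<open>c \<mu> / (y - \<mu>)\<close>. At \<open>w\<close> only the summand of \<open>w\<close>
      survives, which gives \<open>q \<noteq> 0\<close>.\<close>
    define q where "q = (\<Sum>\<mu>\<in>\<Lambda>. smult (c \<mu>) (\<Prod>l\<in>\<Lambda> - {\<mu>}. [:- l, 1:]))"
    have poly_q: "poly q y = (\<Sum>\<mu>\<in>\<Lambda>. c \<mu> * (\<Prod>l\<in>\<Lambda> - {\<mu>}. y - l))" for y
      by (simp add: q_def poly_sum poly_prod)
    have "poly q w = c w * (\<Prod>l\<in>\<Lambda> - {w}. w - l) + (\<Sum>\<mu>\<in>\<Lambda> - {w}. c \<mu> * (\<Prod>l\<in>\<Lambda> - {\<mu>}. w - l))"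
      unfolding poly_q using \<Lambda>(1) c(1) by (rule sum.remove)
    also have "(\<Sum>\<mu>\<in>\<Lambda> - {w}. c \<mu> * (\<Prod>l\<in>\<Lambda> - {\<mu>}. w - l)) = 0"
      using \<Lambda>(1) c(1) by (intro sum.neutral) (auto simp: prod_zero_iff)
    finally have "poly q w \<noteq> 0" using \<Lambda>(1) c(2) by auto
    then have "q \<noteq> 0" by auto
    \<comment> \<open>After multiplying \<open>inv\<close> by \<open>c \<mu>\<close> and the product
      over \<open>\<Lambda> - {\<mu>}\<close>, all terms with \<open>g \<mu>\<close> share the
      product over \<open>\<Lambda>\<close>, and they cancel by \<open>dependent\<close>.\<close>
    have "x i ^ K * poly q (x j) = (\<Sum>\<mu>\<in>\<Lambda>. (c \<mu> * (\<Prod>l\<in>\<Lambda> - {\<mu>}. x j - l)) * m \<mu> x)" for x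
    proof -
      have "x i ^ K * poly q (x j)
          = (\<Sum>\<mu>\<in>\<Lambda>. c \<mu> * g \<mu> x * (\<Prod>l\<in>\<Lambda>. x j - l) + (c \<mu> * (\<Prod>l\<in>\<Lambda> - {\<mu>}. x j - l)) * m \<mu> x)"
        unfolding poly_q sum_distrib_left
      proof (intro sum.cong refl)
        fix \<mu> assume \<mu>: "\<mu> \<in> \<Lambda>"
        then have "x i ^ K = g \<mu> x * (x j - \<mu>) + m \<mu> x" using inv[of x \<mu>] \<Lambda>(3) by auto
        moreover have "(\<Prod>l\<in>\<Lambda>. x j - l) = (x j - \<mu>) * (\<Prod>l\<in>\<Lambda> - {\<mu>}. x j - l)"
          using \<Lambda>(1) \<mu> by (rule prod.remove)
        ultimately show "x i ^ K * (c \<mu> * (\<Prod>l\<in>\<Lambda> - {\<mu>}. x j - l))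
            = c \<mu> * g \<mu> x * (\<Prod>l\<in>\<Lambda>. x j - l) + (c \<mu> * (\<Prod>l\<in>\<Lambda> - {\<mu>}. x j - l)) * m \<mu> x"
          by (simp only: ring_distribs mult_ac)
      qed
      also have "\<dots> = (\<Sum>\<mu>\<in>\<Lambda>. c \<mu> * g \<mu> x) * (\<Prod>l\<in>\<Lambda>. x j - l)
          + (\<Sum>\<mu>\<in>\<Lambda>. (c \<mu> * (\<Prod>l\<in>\<Lambda> - {\<mu>}. x j - l)) * m \<mu> x)"
        by (simp add: sum.distrib sum_distrib_right)
      finally show ?thesis by (simp add: dependent)
    qed
    moreover have "(\<lambda>x. \<Sum>\<mu>\<in>\<Lambda>. (c \<mu> * (\<Prod>l\<in>\<Lambda> - {\<mu>}. x j - l)) * m \<mu> x) \<in> M"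
      using m by (intro poly_ideal_sum[OF M(1)] poly_ideal_mult[OF M(1)] polyfuns_mult polyfuns_prod
          polyfuns_diff polyfuns_const polyfuns_var)
    ultimately have "(\<lambda>x. x i ^ K * poly q (x j)) \<in> M" by simp
    moreover have "(\<lambda>x. poly q (x j)) \<in> polyfuns"
      unfolding poly_altdef
      by (intro polyfuns_sum polyfuns_mult polyfuns_power polyfuns_const polyfuns_var)
    ultimately have "(\<lambda>x. poly q (x j)) \<in> M"
      using prime[OF polyfuns_power[OF polyfuns_var[of i], of K], of "\<lambda>x. poly q (x j)"] M(3)[of K] by blast
    with linear_factor[OF \<open>q \<noteq> 0\<close>] \<open>\<nexists>\<mu>. (\<lambda>x. x j - \<mu>) \<in> M\<close> show False by blast
  qed
  then obtain y where y: "\<And>j. (\<lambda>x. x j - y j) \<in> M" by metis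
  \<comment> \<open>\<open>N f\<close> says that \<open>f\<close> is congruent to the constant
    \<open>f y\<close> modulo \<open>M\<close>. This holds for the coordinates and survives sums and
    products, hence holds for all polynomial functions; as \<open>M\<close> contains no nonzero
    constant, its members vanish at \<open>y\<close>.\<close>
  define N where "N f \<longleftrightarrow> f \<in> polyfuns \<and> (\<lambda>x. f x - f y) \<in> M" for f
  have N_const: "N (\<lambda>x. a)" for a
    by (simp add: N_def poly_ideal_zero[OF M(1)])
  have N_add: "N (\<lambda>x. f x + g x)" if "N f" "N g" for f g
  proof -
    have "(\<lambda>x. (f x - f y) + (g x - g y)) \<in> M"
      using that by (intro poly_ideal_add[OF M(1)]) (simp_all add: N_def)
    then show ?thesis using that by (simp add: N_def polyfuns_add algebra_simps)
  qed
  have N_mult: "N (\<lambda>x. f x * g x)" if "N f" "N g" for f g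
  proof -
    have "(\<lambda>x. f x * (g x - g y) + g y * (f x - f y)) \<in> M"
      using that by (intro poly_ideal_add[OF M(1)] poly_ideal_mult[OF M(1)]) (simp_all add: N_def)
    then show ?thesis using that by (simp add: N_def polyfuns_mult algebra_simps)
  qed
  have N_var: "N (\<lambda>x. x j)" for j using y by (simp add: N_def)
  have N_power: "N (\<lambda>x. f x ^ n)" if "N f" for f n
    by (induction n) (simp_all add: N_const N_mult that)
  have N_prod: "N (\<lambda>x. \<Prod>v\<in>V. f v x)" if "\<And>v. N (f v)" for f V
    by (induction V rule: infinite_finite_induct) (simp_all add: N_const N_mult that)
  have N_sum: "N (\<lambda>x. \<Sum>v\<in>V. f v x)" if "\<And>v. N (f v)" for f V
    by (induction V rule: infinite_finite_induct) (simp_all add: N_const N_add that)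
  have N: "N f" if f: "f \<in> polyfuns" for f
  proof -
    from f obtain A k where "finite A" and f: "f = (\<lambda>x. \<Sum>a\<in>A. k a * monom_eval a x)"
      by (rule polyfuns_obtain)
    show ?thesis
      unfolding f monom_eval_def by (intro N_sum N_mult N_prod N_power N_const N_var)
  qed
  have zero: "f y = 0" if "f \<in> M" for f
  proof -
    have "(\<lambda>x. f x - f y) \<in> M" using N that M(1) by (auto simp: N_def poly_ideal_polyfuns)
    then have "(\<lambda>x. (f x - f y) + (-1) * f x) \<in> M"
      using that by (intro poly_ideal_add[OF M(1)] poly_ideal_mult[OF M(1)]) auto
    then have "(\<lambda>x. - f y) \<in> M" by simp
    then show ?thesis using const by fastforce
  qed
  have "y i \<noteq> 0"
    using y[of i] M(3)[of 1] by auto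
  then show ?thesis using zero M(2) by blast
qed

subsection \<open>Elimination\<close>

text \<open>\<open>P\<close> is a substitute for the determinant, obtained by iterated fraction-free Schur
  complements.\<close>

lemma singular_matrix_polyfun:
  fixes A :: "('v \<Rightarrow> complex) \<Rightarrow> 'b \<Rightarrow> 'b \<Rightarrow> complex"
  assumes "finite B" "\<And>a b. a \<in> B \<Longrightarrow> b \<in> B \<Longrightarrow> (\<lambda>z. A z a b) \<in> polyfuns"
    "\<And>a b. a \<in> B \<Longrightarrow> b \<in> B \<Longrightarrow> A c a b = (if a = b then 1 else 0)"
  shows "\<exists>P\<in>polyfuns. P c = 1 \<and>
    (\<forall>z v. (\<exists>b\<in>B. v b \<noteq> 0) \<longrightarrow> (\<forall>a\<in>B. (\<Sum>b\<in>B. A z a b * v b) = 0) \<longrightarrow> P z = 0)"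
  using assms
proof (induction B arbitrary: A rule: finite_induct)
  case empty
  then show ?case by (intro bexI[of _ "\<lambda>_. 1"]) auto
next
  case (insert p B)
  define A' where "A' z a b = A z p p * A z a b - A z a p * A z p b" for z a b
  have "\<exists>P\<in>polyfuns. P c = 1 \<and>
    (\<forall>z v. (\<exists>b\<in>B. v b \<noteq> 0) \<longrightarrow> (\<forall>a\<in>B. (\<Sum>b\<in>B. A' z a b * v b) = 0) \<longrightarrow> P z = 0)"
  proof (rule insert.IH)
    fix a b assume ab: "a \<in> B" "b \<in> B"
    then show "(\<lambda>z. A' z a b) \<in> polyfuns"
      unfolding A'_def by (intro polyfuns_diff polyfuns_mult insert.prems) auto
    from ab insert.hyps have "a \<noteq> p" "b \<noteq> p" by auto
    then show "A' c a b = (if a = b then 1 else 0)"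
      using insert.prems(2) ab by (simp add: A'_def)
  qed
  then obtain P where P: "P \<in> polyfuns" "P c = 1"
    "\<And>z v. \<exists>b\<in>B. v b \<noteq> 0 \<Longrightarrow> \<forall>a\<in>B. (\<Sum>b\<in>B. A' z a b * v b) = 0 \<Longrightarrow> P z = 0" by blast
  show ?case
  \<comment> \<open>The factor \<open>A z p p\<close> covers the points where the pivot vanishes.
    Elsewhere the equation of \<open>p\<close> determines \<open>v p\<close>, so a nonzero kernel
    vector is already nonzero on \<open>B\<close>.\<close>
  proof (intro bexI[of _ "\<lambda>z. A z p p * P z"] conjI allI impI)
    show "(\<lambda>z. A z p p * P z) \<in> polyfuns"
      by (intro polyfuns_mult insert.prems P) auto
    show "A c p p * P c = 1" using insert.prems(2) P by simp
    fix z v assume v: "\<exists>b\<in>insert p B. v b \<noteq> 0"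
      and "\<forall>a\<in>insert p B. (\<Sum>b\<in>insert p B. A z a b * v b) = 0"
    then have kernel: "A z a p * v p + (\<Sum>b\<in>B. A z a b * v b) = 0" if "a \<in> insert p B" for a
      using insert.hyps that by auto
    show "A z p p * P z = 0"
    proof (cases "A z p p = 0")
      case False
      have "\<exists>b\<in>B. v b \<noteq> 0"
      proof (rule ccontr)
        assume "\<not> ?thesis"
        with kernel[of p] have "A z p p * v p = 0" by simp
        with False v \<open>\<not> ?thesis\<close> show False by auto
      qed
      moreover have "(\<Sum>b\<in>B. A' z a b * v b) = 0" if "a \<in> B" for a
      proof -
        have "(\<Sum>b\<in>B. A' z a b * v b)
            = A z p p * (\<Sum>b\<in>B. A z a b * v b) - A z a p * (\<Sum>b\<in>B. A z p b * v b)"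
          by (simp add: A'_def sum_distrib_left sum_subtractf left_diff_distrib mult.assoc)
        also have "\<dots> = A z p p * - (A z a p * v p) - A z a p * - (A z p p * v p)"
          using kernel[of a] kernel[of p] that by (simp add: add_eq_0_iff)
        finally show ?thesis by simp
      qed
      ultimately show ?thesis using P(3) by simp
    qed simp
  qed
qed

text \<open>Systems are points of the space of all coefficient families, matching the indeterminates
  of the resultant, so that \<open>polyfuns\<close> applies; entries of degree other than
  \<open>d\<close> are ignored.\<close>

definition form_eval ::
  "nat \<Rightarrow> ('n \<times> ('n \<Rightarrow>\<^sub>0 nat) \<Rightarrow> complex) \<Rightarrow> 'n \<Rightarrow> ('n \<Rightarrow> complex) \<Rightarrow> complex" where
  "form_eval d c i x = (\<Sum>b | monom_degree b = d. c (i, b) * monom_eval b x)"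

definition singular_systems :: "nat \<Rightarrow> ('n \<times> ('n \<Rightarrow>\<^sub>0 nat) \<Rightarrow> complex) set" where
  "singular_systems d = {c. \<exists>x. x \<noteq> (\<lambda>_. 0) \<and> (\<forall>i. form_eval d c i x = 0)}"

lemma finite_monom_degree_eq [simp]: "finite {a :: 'n::finite \<Rightarrow>\<^sub>0 nat. monom_degree a = D}"
  by (rule finite_subset[OF _ finite_monom_degree_le[of D]]) auto

lemma form_eval_polyfuns: "form_eval d c i \<in> polyfuns"
  unfolding form_eval_def by (intro polyfuns_sum polyfuns_mult polyfuns_const polyfuns_monom_eval)

lemma form_eval_scale: "form_eval d c i (\<lambda>j. s * x j) = s ^ d * form_eval d c i x"
  unfolding form_eval_def sum_distrib_left by (intro sum.cong) (auto simp: monom_eval_scale)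

text \<open>Comparing the coefficients of \<open>s ^ M\<close> after scaling \<open>x\<close> by \<open>s\<close> makes the cofactors of a
  monomial homogeneous.\<close>

lemma homogeneous_cofactors:
  fixes c :: "'n::finite \<times> ('n \<Rightarrow>\<^sub>0 nat) \<Rightarrow> complex"
  assumes h: "\<And>i. h i \<in> polyfuns" "\<And>x. monom_eval a x = (\<Sum>i\<in>UNIV. h i x * form_eval d c i x)"
    and a: "monom_degree a = M" "d \<le> M"
  shows "\<exists>\<kappa>. \<forall>x. monom_eval a x =
    (\<Sum>i\<in>UNIV. \<Sum>g | monom_degree g = M - d. \<kappa> i g * monom_eval g x * form_eval d c i x)"
proof -
  have "\<exists>A k. finite A \<and> h i = (\<lambda>x. \<Sum>a\<in>A. k a * monom_eval a x)" for i
    using h(1)[of i] by (rule polyfuns_obtain) blast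
  then obtain A k where A: "\<And>i. finite (A i)" "\<And>i. h i = (\<lambda>x. \<Sum>a\<in>A i. k i a * monom_eval a x)"
    by metis
  have "monom_eval a x = (\<Sum>i\<in>UNIV. \<Sum>g | monom_degree g = M - d.
      (if g \<in> A i then k i g else 0) * monom_eval g x * form_eval d c i x)" for x
  proof -
    define p where "p = (\<Sum>i\<in>UNIV. \<Sum>g\<in>A i.
      monom (k i g * monom_eval g x * form_eval d c i x) (monom_degree g + d))"
    have "poly (monom (monom_eval a x) M) s = poly p s" for s
    proof -
      have "poly (monom (monom_eval a x) M) s = monom_eval a (\<lambda>j. s * x j)"
        by (simp add: poly_monom monom_eval_scale a mult.commute)
      also have "\<dots> = poly p s"
        unfolding h(2) A(2) p_def poly_sum sum_distrib_right
        by (simp add: poly_monom monom_eval_scale form_eval_scale power_add mult_ac)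
      finally show ?thesis .
    qed
    then have "monom (monom_eval a x) M = p"
      by (simp add: poly_eq_poly_eq_iff[symmetric] fun_eq_iff)
    then have "monom_eval a x = coeff p M" by (metis coeff_monom)
    also have "\<dots> = (\<Sum>i\<in>UNIV. \<Sum>g\<in>A i. if monom_degree g = M - d
        then k i g * monom_eval g x * form_eval d c i x else 0)"
      unfolding p_def coeff_sum using a(2) by (intro sum.cong) auto
    also have "\<dots> = (\<Sum>i\<in>UNIV. \<Sum>g | monom_degree g = M - d.
        (if g \<in> A i then k i g else 0) * monom_eval g x * form_eval d c i x)"
    proof (rule sum.cong[OF refl])
      fix i
      have "(\<Sum>g\<in>A i. if monom_degree g = M - d then k i g * monom_eval g x * form_eval d c i x else 0)
          = (\<Sum>g | g \<in> A i \<and> monom_degree g = M - d. k i g * monom_eval g x * form_eval d c i x)"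
        using A(1)[of i] by (simp add: sum.If_cases Int_def)
      also have "\<dots> = (\<Sum>g | monom_degree g = M - d.
          (if g \<in> A i then k i g else 0) * monom_eval g x * form_eval d c i x)"
        by (rule sum.mono_neutral_cong_left) auto
      finally show "(\<Sum>g\<in>A i. if monom_degree g = M - d then k i g * monom_eval g x * form_eval d c i x else 0)
          = (\<Sum>g | monom_degree g = M - d. (if g \<in> A i then k i g else 0) * monom_eval g x * form_eval d c i x)" .
    qed
    finally show ?thesis .
  qed
  then show ?thesis by (intro exI[of _ "\<lambda>i g. if g \<in> A i then k i g else 0"]) auto
qed

text \<open>Without a nonzero common zero, the Nullstellensatz puts a power of each variable into
  the ideal of the forms, and every monomial of large degree is divisible by one of these
  powers.\<close>

lemma monoms_in_ideal_of_nonsingular: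
  fixes c :: "'n::finite \<times> ('n \<Rightarrow>\<^sub>0 nat) \<Rightarrow> complex"
  assumes "c \<notin> singular_systems d"
  obtains M where "d \<le> M" "\<And>a. monom_degree a = M \<Longrightarrow>
    \<exists>h. (\<forall>i. h i \<in> polyfuns) \<and> (\<forall>x. monom_eval a x = (\<Sum>i\<in>UNIV. h i x * form_eval d c i x))"
proof -
  define J where "J = {\<lambda>x. \<Sum>i\<in>UNIV. h i x * form_eval d c i x | h. \<forall>i. h i \<in> polyfuns}"
  have J: "poly_ideal J"
    unfolding poly_ideal_def
  proof (intro conjI ballI)
    show "J \<subseteq> polyfuns"
      unfolding J_def by (auto intro!: polyfuns_sum polyfuns_mult form_eval_polyfuns)
    show "(\<lambda>x. 0) \<in> J"
      unfolding J_def by (auto intro!: exI[of _ "\<lambda>_ _. 0"])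
    fix f assume "f \<in> J"
    then obtain h where h: "\<forall>i. h i \<in> polyfuns" "f = (\<lambda>x. \<Sum>i\<in>UNIV. h i x * form_eval d c i x)"
      by (auto simp: J_def)
    show "(\<lambda>x. u x * f x) \<in> J" if "u \<in> polyfuns" for u
      unfolding J_def using h that
      by (auto intro!: exI[of _ "\<lambda>i x. u x * h i x"] polyfuns_mult simp: sum_distrib_left mult.assoc)
    fix g assume "g \<in> J"
    then obtain h' where h': "\<forall>i. h' i \<in> polyfuns" "g = (\<lambda>x. \<Sum>i\<in>UNIV. h' i x * form_eval d c i x)"
      by (auto simp: J_def)
    show "(\<lambda>x. f x + g x) \<in> J"
      unfolding J_def using h h'
      by (auto intro!: exI[of _ "\<lambda>i x. h i x + h' i x"] polyfuns_add simp: sum.distrib distrib_right)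
  qed
  have form_J: "form_eval d c i \<in> J" for i
  proof -
    have "form_eval d c i = (\<lambda>x. \<Sum>j\<in>UNIV. (if j = i then 1 else 0) * form_eval d c j x)"
      by (simp add: if_distrib[of "\<lambda>y. y * _"] cong: if_cong)
    then show ?thesis
      unfolding J_def by (auto intro!: exI[of _ "\<lambda>j x. if j = i then 1 else 0"])
  qed
  have "\<exists>k. (\<lambda>x. x i ^ k) \<in> J" for i
  proof (rule ccontr)
    assume "\<nexists>k. (\<lambda>x. x i ^ k) \<in> J"
    then obtain x where "x i \<noteq> 0" "\<forall>f\<in>J. f x = 0"
      using nullstellensatz[OF J, of i] by blast
    then have "c \<in> singular_systems d"
      unfolding singular_systems_def using form_J by (auto intro!: exI[of _ x])
    with assms show False by simp
  qed
  then obtain k where k: "\<And>i. (\<lambda>x. x i ^ k i) \<in> J" by metis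
  \<comment> \<open>Beyond the sum of the \<open>k i\<close>, some exponent must reach its
    \<open>k i\<close>; the summand \<open>d\<close> makes the cofactor degree \<open>M - d\<close>
    meaningful.\<close>
  define M where "M = Suc (\<Sum>i\<in>UNIV. k i) + d"
  have monom_J: "monom_eval a \<in> J" if a: "monom_degree a = M" for a
  proof -
    have "\<exists>i. k i \<le> Poly_Mapping.lookup a i"
    proof (rule ccontr)
      assume "\<nexists>i. k i \<le> Poly_Mapping.lookup a i"
      then have "(\<Sum>i\<in>UNIV. Poly_Mapping.lookup a i) \<le> (\<Sum>i\<in>UNIV. k i)"
        by (intro sum_mono) (simp add: not_le less_imp_le)
      with a show False by (simp add: M_def monom_degree_UNIV)
    qed
    then obtain i where i: "k i \<le> Poly_Mapping.lookup a i" by blast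
    have "a = (a - Poly_Mapping.single i (k i)) + Poly_Mapping.single i (k i)"
      using i by (intro poly_mapping_eqI) (auto simp: lookup_add lookup_minus lookup_single when_def)
    then have "monom_eval a = (\<lambda>x. monom_eval (a - Poly_Mapping.single i (k i)) x * x i ^ k i)"
      by (metis (no_types, lifting) ext monom_eval_add monom_eval_single)
    also have "\<dots> \<in> J" using J k by (rule poly_ideal_mult) (rule polyfuns_monom_eval)
    finally show ?thesis .
  qed
  have "\<exists>h. (\<forall>i. h i \<in> polyfuns) \<and> (\<forall>x. monom_eval a x = (\<Sum>i\<in>UNIV. h i x * form_eval d c i x))"
    if deg: "monom_degree a = M" for a
  proof -
    obtain h where "\<forall>i. h i \<in> polyfuns" "monom_eval a = (\<lambda>x. \<Sum>i\<in>UNIV. h i x * form_eval d c i x)"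
      using monom_J[OF deg] unfolding J_def by blast
    then show ?thesis by (intro exI[of _ h]) simp
  qed
  then show ?thesis by (intro that[of M]) (simp_all add: M_def)
qed

text \<open>In a suitable degree \<open>M\<close> the multiples of a nonsingular system \<open>c\<close> contain all monomials, and
  with the cofactors kept fixed the matrix that expresses this depends linearly on the system. It
  is the identity at \<open>c\<close>, and at a singular system it has the monomials of a zero as kernel.\<close>

lemma nonsingular_separation:
  fixes c :: "'n::finite \<times> ('n \<Rightarrow>\<^sub>0 nat) \<Rightarrow> complex"
  assumes "c \<notin> singular_systems d"
  shows "\<exists>P\<in>polyfuns. P c = 1 \<and> (\<forall>z\<in>singular_systems d. P z = 0)"
proof -
  obtain M where M: "d \<le> M" "\<And>a. monom_degree a = M \<Longrightarrow>
    \<exists>h. (\<forall>i. h i \<in> polyfuns) \<and> (\<forall>x. monom_eval a x = (\<Sum>i\<in>UNIV. h i x * form_eval d c i x))"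
    using monoms_in_ideal_of_nonsingular[OF assms] by blast
  let ?B = "{a :: 'n \<Rightarrow>\<^sub>0 nat. monom_degree a = M}"
  have "\<forall>a\<in>?B. \<exists>\<kappa>. \<forall>x. monom_eval a x =
    (\<Sum>i\<in>UNIV. \<Sum>g | monom_degree g = M - d. \<kappa> i g * monom_eval g x * form_eval d c i x)"
  proof
    fix a assume "a \<in> ?B"
    then have a: "monom_degree a = M" by simp
    obtain h where "\<And>i. h i \<in> polyfuns"
      "\<And>x. monom_eval a x = (\<Sum>i\<in>UNIV. h i x * form_eval d c i x)"
      using M(2)[OF a] by auto
    then show "\<exists>\<kappa>. \<forall>x. monom_eval a x =
      (\<Sum>i\<in>UNIV. \<Sum>g | monom_degree g = M - d. \<kappa> i g * monom_eval g x * form_eval d c i x)"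
      by (rule homogeneous_cofactors[OF _ _ a M(1)])
  qed
  from bchoice[OF this] obtain \<kappa> where \<kappa>: "\<And>a x. monom_degree a = M \<Longrightarrow> monom_eval a x =
    (\<Sum>i\<in>UNIV. \<Sum>g | monom_degree g = M - d. \<kappa> a i g * monom_eval g x * form_eval d c i x)"
    by auto
  \<comment> \<open>Row \<open>a\<close> lists the coefficients of the combination of the forms of
    \<open>z\<close> with the cofactors \<open>\<kappa> a\<close>, as in Macaulay's
    matrices.\<close>
  define E where "E z a a' = (\<Sum>i\<in>UNIV. \<Sum>g | monom_degree g = M - d. \<Sum>b | monom_degree b = d.
    if a' = g + b then \<kappa> a i g * z (i, b) else 0)" for z a a'
  have E: "(\<Sum>a'\<in>?B. E z a a' * monom_eval a' x)
      = (\<Sum>i\<in>UNIV. \<Sum>g | monom_degree g = M - d. \<kappa> a i g * monom_eval g x * form_eval d z i x)" for z a x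
  proof -
    have "(\<Sum>a'\<in>?B. E z a a' * monom_eval a' x)
        = (\<Sum>a'\<in>?B. \<Sum>i\<in>UNIV. \<Sum>g | monom_degree g = M - d. \<Sum>b | monom_degree b = d.
            if a' = g + b then \<kappa> a i g * z (i, b) * monom_eval a' x else 0)"
      by (simp add: E_def sum_distrib_right if_distrib[of "\<lambda>y. y * _"] cong: if_cong)
    also have "\<dots> = (\<Sum>i\<in>UNIV. \<Sum>a'\<in>?B. \<Sum>g | monom_degree g = M - d. \<Sum>b | monom_degree b = d.
            if a' = g + b then \<kappa> a i g * z (i, b) * monom_eval a' x else 0)"
      by (rule sum.swap)
    also have "\<dots> = (\<Sum>i\<in>UNIV. \<Sum>g | monom_degree g = M - d. \<Sum>a'\<in>?B. \<Sum>b | monom_degree b = d.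
            if a' = g + b then \<kappa> a i g * z (i, b) * monom_eval a' x else 0)"
      by (intro sum.cong refl sum.swap)
    also have "\<dots> = (\<Sum>i\<in>UNIV. \<Sum>g | monom_degree g = M - d. \<Sum>b | monom_degree b = d. \<Sum>a'\<in>?B.
            if a' = g + b then \<kappa> a i g * z (i, b) * monom_eval a' x else 0)"
      by (intro sum.cong refl sum.swap)
    also have "\<dots> = (\<Sum>i\<in>UNIV. \<Sum>g | monom_degree g = M - d. \<Sum>b | monom_degree b = d.
            \<kappa> a i g * z (i, b) * monom_eval (g + b) x)"
      using M(1) by (intro sum.cong refl) (simp add: monom_degree_add)
    also have "\<dots> = (\<Sum>i\<in>UNIV. \<Sum>g | monom_degree g = M - d. \<kappa> a i g * monom_eval g x * form_eval d z i x)"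
      by (simp add: form_eval_def sum_distrib_left monom_eval_add mult_ac)
    finally show ?thesis .
  qed
  have "E c a a' = (if a = a' then 1 else 0)" if "a \<in> ?B" "a' \<in> ?B" for a a'
  proof -
    have "(\<Sum>a'\<in>?B. (E c a a' - (if a = a' then 1 else 0)) * monom_eval a' x) = 0" for x
    proof -
      have "(\<Sum>a'\<in>?B. (E c a a' - (if a = a' then 1 else 0)) * monom_eval a' x)
          = (\<Sum>a'\<in>?B. E c a a' * monom_eval a' x) - (\<Sum>a'\<in>?B. if a = a' then monom_eval a' x else 0)"
        by (simp add: left_diff_distrib sum_subtractf if_distrib[of "\<lambda>y. y * _"] cong: if_cong)
      also have "\<dots> = 0" using that(1) by (simp add: E \<kappa>[symmetric])
      finally show ?thesis .
    qed
    from monom_eval_independent[OF _ this that(2)] show ?thesis by simp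
  qed
  moreover have "(\<lambda>z. E z a a') \<in> polyfuns" for a a'
    unfolding E_def
    by (intro polyfuns_sum polyfuns_if polyfuns_mult polyfuns_const polyfuns_var)
  ultimately obtain P where P: "P \<in> polyfuns" "P c = 1"
    "\<And>z v. \<exists>b\<in>?B. v b \<noteq> 0 \<Longrightarrow> \<forall>a\<in>?B. (\<Sum>b\<in>?B. E z a b * v b) = 0 \<Longrightarrow> P z = 0"
    using singular_matrix_polyfun[of ?B E c] by auto
  have "P z = 0" if "z \<in> singular_systems d" for z
  proof -
    from that obtain x i where x: "x i \<noteq> 0" "\<And>i. form_eval d z i x = 0"
      by (auto simp: singular_systems_def fun_eq_iff)
    have "monom_eval (Poly_Mapping.single i M) x \<noteq> 0" using x by simp
    then show ?thesis
      using x(2) by (intro P(3)[of "\<lambda>a. monom_eval a x"]) (auto simp: E intro!: exI[of _ "Poly_Mapping.single i M"])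
  qed
  with P show ?thesis by blast
qed

section \<open>The resultant\<close>

lemma form_eval_add_scaled:
  "form_eval d (\<lambda>v. a * c v + b * c' v) i x = a * form_eval d c i x + b * form_eval d c' i x"
  by (simp add: form_eval_def sum.distrib sum_distrib_left algebra_simps)

lemma form_eval_zero: "d > 0 \<Longrightarrow> form_eval d c i (\<lambda>_. 0) = 0"
  using form_eval_scale[of d c i 0 "\<lambda>_. 0"] by (simp add: power_0_left)

lemma form_eval_cong:
  "(\<And>b. monom_degree b = d \<Longrightarrow> c (i, b) = c' (i, b)) \<Longrightarrow> form_eval d c i x = form_eval d c' i x"
  by (simp add: form_eval_def)

lemma form_eval_pure_powers:
  fixes i :: "'n::finite"
  shows "form_eval d (system_coeffs (pure_powers d)) i x = x i ^ d"
  by (simp add: form_eval_def system_coeffs_def pure_powers_def lookup_single when_def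
      if_distrib[of "\<lambda>y. y * _"] cong: if_cong)

lemma pure_powers_nonsingular:
  assumes "d > 0"
  shows "system_coeffs (pure_powers d) \<notin> (singular_systems d :: ('n::finite \<times> _ \<Rightarrow> _) set)"
  using assms by (auto simp: singular_systems_def form_eval_pure_powers fun_eq_iff)

lemma singular_systems_scale:
  "c \<in> singular_systems d \<Longrightarrow> (\<lambda>v. s * c v) \<in> singular_systems d"
  using form_eval_add_scaled[of d s c 0 c] by (auto simp: singular_systems_def)

lemma form_eval_curve:
  assumes "\<And>b. (\<lambda>s. c s (i, b)) \<in> range (poly :: complex poly \<Rightarrow> _)"
    and "\<And>j. (\<lambda>s. x s j) \<in> range (poly :: complex poly \<Rightarrow> _)"
  shows "(\<lambda>s. form_eval d (c s) i (x s)) \<in> range poly"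
  unfolding form_eval_def monom_eval_def
  by (intro range_poly_sum range_poly_mult range_poly_prod range_poly_power assms)

text \<open>With \<open>\<psi> = \<Sum>\<^sub>j l\<^sub>j X\<^sub>j\<^sup>d\<close>, the system \<open>\<psi>(x) c - c(x) \<psi>\<close> vanishes at \<open>x\<close>, and every singular
  system is of this form. So the singular systems are the polynomial image of an affine space.\<close>

lemma singular_systems_prime:
  fixes f g :: "('n::finite \<times> ('n \<Rightarrow>\<^sub>0 nat) \<Rightarrow> complex) \<Rightarrow> complex"
  assumes d: "d > 0" and f: "f \<in> polyfuns" and g: "g \<in> polyfuns"
    and zero: "\<forall>c\<in>singular_systems d. f c * g c = 0"
  shows "(\<forall>c\<in>singular_systems d. f c = 0) \<or> (\<forall>c\<in>singular_systems d. g c = 0)"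
proof (rule ccontr)
  define \<psi> :: "('n \<Rightarrow> complex) \<Rightarrow> ('n \<Rightarrow>\<^sub>0 nat) \<Rightarrow> complex"
    where "\<psi> l b = (\<Sum>j\<in>UNIV. if b = Poly_Mapping.single j d then l j else 0)" for l b
  define \<Phi> :: "('n \<times> ('n \<Rightarrow>\<^sub>0 nat) \<Rightarrow> complex) \<Rightarrow> ('n \<Rightarrow> complex) \<Rightarrow> ('n \<Rightarrow> complex) \<Rightarrow> 'n \<times> ('n \<Rightarrow>\<^sub>0 nat) \<Rightarrow> complex"
    where "\<Phi> c x l = (\<lambda>(i, b). (\<Sum>j\<in>UNIV. l j * x j ^ d) * c (i, b) - form_eval d c i x * \<psi> l b)" for c x l
  have \<psi>: "(\<Sum>b | monom_degree b = d. \<psi> l b * monom_eval b y) = (\<Sum>j\<in>UNIV. l j * y j ^ d)" for l y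
  proof -
    have "(\<Sum>b | monom_degree b = d. \<psi> l b * monom_eval b y) = (\<Sum>b | monom_degree b = d. \<Sum>j\<in>UNIV.
        if b = Poly_Mapping.single j d then l j * monom_eval b y else 0)"
      by (simp add: \<psi>_def sum_distrib_right if_distrib[of "\<lambda>y. y * _"] cong: if_cong)
    also have "\<dots> = (\<Sum>j\<in>UNIV. \<Sum>b | monom_degree b = d.
        if b = Poly_Mapping.single j d then l j * monom_eval b y else 0)"
      by (rule sum.swap)
    also have "\<dots> = (\<Sum>j\<in>UNIV. l j * y j ^ d)"
      by (intro sum.cong) simp_all
    finally show ?thesis .
  qed
  have form_\<Phi>: "form_eval d (\<Phi> c x l) i y
      = (\<Sum>j\<in>UNIV. l j * x j ^ d) * form_eval d c i y - form_eval d c i x * (\<Sum>j\<in>UNIV. l j * y j ^ d)"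
    for c x l i y
  proof -
    have "form_eval d (\<Phi> c x l) i y = (\<Sum>j\<in>UNIV. l j * x j ^ d) * form_eval d c i y
        - form_eval d c i x * (\<Sum>b | monom_degree b = d. \<psi> l b * monom_eval b y)"
      unfolding form_eval_def[of d "\<Phi> c x l"] form_eval_def[of d c i y]
      by (simp add: \<Phi>_def sum_subtractf sum_distrib_left left_diff_distrib mult.assoc)
    then show ?thesis by (simp only: \<psi>)
  qed
  have \<Phi>_singular: "\<Phi> c x l \<in> singular_systems d" for c x l
  \<comment> \<open>At \<open>x = 0\<close> all forms of \<open>\<Phi> c x l\<close> vanish
    identically because \<open>d > 0\<close>. Allowing this point keeps the parameter space affine,
    so that parameters can be joined by lines.\<close>
  proof (cases "x = (\<lambda>_. 0)")
    case True
    then have "form_eval d (\<Phi> c x l) i y = 0" for i y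
      using d by (simp add: form_\<Phi> form_eval_zero power_0_left)
    then show ?thesis
      by (auto simp: singular_systems_def fun_eq_iff intro!: exI[of _ "\<lambda>_. 1"])
  next
    case False
    then show ?thesis
      unfolding singular_systems_def by (auto simp: form_\<Phi> intro!: exI[of _ x])
  qed
  have \<Phi>_surj: "\<exists>x l. \<Phi> c x l = c" if singular: "c \<in> singular_systems d" for c
  proof -
    obtain x i where x: "x i \<noteq> 0" "\<And>i. form_eval d c i x = 0"
      using singular by (auto simp: singular_systems_def fun_eq_iff)
    \<comment> \<open>Chosen to make the form \<open>\<psi>\<close> equal to 1 at \<open>x\<close>;
      as the forms of \<open>c\<close> vanish there, \<open>\<Phi>\<close> returns
      \<open>c\<close>.\<close>
    let ?l = "\<lambda>j. if j = i then 1 / x i ^ d else 0"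
    have "(\<Sum>j\<in>UNIV. ?l j * x j ^ d) = 1"
      using x(1) by (simp add: if_distrib[of "\<lambda>y. y * _"] cong: if_cong)
    then have "\<Phi> c x ?l = c" by (auto simp: \<Phi>_def x(2))
    then show ?thesis by blast
  qed
  assume "\<not> ?thesis"
  then obtain c c' where c: "c \<in> singular_systems d" "f c \<noteq> 0" "c' \<in> singular_systems d" "g c' \<noteq> 0"
    by blast
  obtain x l where xl: "\<Phi> c x l = c" using \<Phi>_surj[OF c(1)] by blast
  obtain x' l' where xl': "\<Phi> c' x' l' = c'" using \<Phi>_surj[OF c(3)] by blast
  \<comment> \<open>The image of the line joining the parameters of the two counterexamples. One of
    \<open>f\<close> and \<open>g\<close> must vanish along all of it, against the values at
    \<open>s = 0\<close> and \<open>s = 1\<close>.\<close>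
  define \<gamma> where "\<gamma> s = \<Phi> (\<lambda>v. c v + s * (c' v - c v)) (\<lambda>j. x j + s * (x' j - x j))
    (\<lambda>j. l j + s * (l' j - l j))" for s
  have line: "(\<lambda>s. a + s * b) \<in> range poly" for a b :: complex
    by (intro range_poly_add range_poly_mult range_poly_const range_poly_id)
  have \<gamma>_curve: "(\<lambda>s. \<gamma> s v) \<in> range poly" for v
  proof (cases v)
    case (Pair i b)
    have \<psi>_curve: "(\<lambda>s. \<psi> (\<lambda>j. l j + s * (l' j - l j)) b) \<in> range poly"
      unfolding \<psi>_def
    proof (intro range_poly_sum)
      fix j
      show "(\<lambda>s. if b = Poly_Mapping.single j d then l j + s * (l' j - l j) else 0) \<in> range poly"
        using line by (cases "b = Poly_Mapping.single j d") (simp_all del: image_iff)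
    qed
    have sum_curve: "(\<lambda>s. \<Sum>j\<in>UNIV. (l j + s * (l' j - l j)) * (x j + s * (x' j - x j)) ^ d) \<in> range poly"
      by (intro range_poly_sum range_poly_mult range_poly_power line)
    have form_curve: "(\<lambda>s. form_eval d (\<lambda>v. c v + s * (c' v - c v)) i (\<lambda>j. x j + s * (x' j - x j))) \<in> range poly"
      using line by (intro form_eval_curve) blast+
    show ?thesis
      using range_poly_diff[OF range_poly_mult[OF sum_curve line[of "c (i, b)" "c' (i, b) - c (i, b)"]] range_poly_mult[OF form_curve \<psi>_curve]]
      unfolding \<gamma>_def \<Phi>_def Pair prod.case .
  qed
  have "\<gamma> s \<in> singular_systems d" for s
    unfolding \<gamma>_def by (rule \<Phi>_singular)
  with zero have "f (\<gamma> s) * g (\<gamma> s) = 0" for s by blast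
  then have "f (\<gamma> 0) = 0 \<or> g (\<gamma> 1) = 0"
    by (rule range_poly_mult_eq_zero[OF polyfuns_curve[OF f \<gamma>_curve] polyfuns_curve[OF g \<gamma>_curve]])
  then show False using c by (simp add: \<gamma>_def xl xl')
qed

lemma norm_monom_eval_le_1:
  assumes "\<And>i. norm (x i) \<le> 1"
  shows "norm (monom_eval a x) \<le> 1"
  unfolding monom_eval_def prod_norm[symmetric]
  using assms by (intro prod_le_1) (simp add: norm_power power_le_one)

text \<open>The singular systems have codimension one: near the system \<open>x\<^sub>i x\<^sub>n\<^sup>d\<^sup>-\<^sup>1\<close> (\<open>i \<noteq> n\<close>), \<open>0\<close> every system
  can be made singular by adding a multiple of the pure powers, since by Brouwer's theorem the
  equations for the zero and the multiple are solvable there.\<close>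

lemma singular_systems_plus_pure_powers_dense:
  fixes f :: "('n::finite \<times> ('n \<Rightarrow>\<^sub>0 nat) \<Rightarrow> complex) \<Rightarrow> complex"
  assumes d: "d > 0" and f: "f \<in> polyfuns"
    and zero: "\<And>c t. (\<lambda>v. c v + t * system_coeffs (pure_powers d) v) \<in> singular_systems d \<Longrightarrow> f c = 0"
  shows "f c = 0"
proof -
  obtain n :: 'n where True by simp
  define W where "W = (UNIV :: 'n set) \<times> {b :: 'n \<Rightarrow>\<^sub>0 nat. monom_degree b = d}"
  define N where "N = card {b :: 'n \<Rightarrow>\<^sub>0 nat. monom_degree b = d}"
  \<comment> \<open>The \<open>N\<close> coefficients of a form, perturbed by at most
    \<open>e\<close> each, change its value by at most \<open>N * e \<le> 1 / 4\<close> where all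
    coordinates have norm at most 1.\<close>
  define e where "e = 1 / (4 * (real N + 1))"
  define c0 :: "'n \<times> ('n \<Rightarrow>\<^sub>0 nat) \<Rightarrow> complex" where
    "c0 = (\<lambda>(i, b). if i \<noteq> n \<and> b = Poly_Mapping.single i 1 + Poly_Mapping.single n (d - 1) then 1 else 0)"
  have form_c0: "form_eval d c0 i x = (if i = n then 0 else x i * x n ^ (d - 1))" for i x
    using d by (simp add: form_eval_def c0_def monom_degree_add monom_eval_add
        if_distrib[of "\<lambda>y. y * _"] cong: if_cong)
  show ?thesis
  proof (rule polyfuns_eq_zero_of_box[OF f])
    show "finite W" by (simp add: W_def)
    show "e > 0" by (simp add: e_def add_nonneg_pos)
    fix c :: "'n \<times> ('n \<Rightarrow>\<^sub>0 nat) \<Rightarrow> complex"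
    assume near: "\<And>v. v \<in> W \<Longrightarrow> norm (c v - c0 v) \<le> e"
    define \<delta> where "\<delta> v = c v - c0 v" for v
    \<comment> \<open>The coordinate \<open>n\<close> of the zero is normalized to 1, which frees
      \<open>z $ n\<close> to be the multiple of the pure powers.\<close>
    define X where "X z i = (if i = n then 1 else z $ i)" for z :: "complex ^ 'n" and i
    define K where "K = {z :: complex ^ 'n. \<forall>i. norm (z $ i) \<le> 1 / 2}"
    \<comment> \<open>A fixed point solves the system. The form of \<open>c0\<close> cancels
      \<open>z $ i\<close> for \<open>i \<noteq> n\<close>, and the pure power cancels
      \<open>z $ n\<close> for \<open>i = n\<close>. What remains is the perturbation and, for
      \<open>i \<noteq> n\<close>, the product \<open>z $ n * z $ i ^ d\<close>, each of norm at
      most 1/4 on \<open>K\<close>.\<close>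
    define T where "T z = (\<chi> i. z $ i - form_eval d c i (X z) - z $ n * X z i ^ d)" for z :: "complex ^ 'n"
    have form_c: "form_eval d c i x = form_eval d c0 i x + form_eval d \<delta> i x" for i x
      using form_eval_add_scaled[of d 1 c0 1 \<delta> i x] by (simp add: \<delta>_def)
    have form_\<delta>: "norm (form_eval d \<delta> i (X z)) \<le> 1 / 4" if "z \<in> K" for i z
    proof -
      have "norm (X z j) \<le> 1" for j
        using that by (auto simp: X_def K_def intro: order.trans[of _ "1 / 2"])
      then have "norm (\<delta> (i, b) * monom_eval b (X z)) \<le> e * 1" if "monom_degree b = d" for b
        unfolding norm_mult using near[of "(i, b)"] that \<open>e > 0\<close>
        by (intro mult_mono norm_monom_eval_le_1) (auto simp: \<delta>_def W_def)
      then have "norm (form_eval d \<delta> i (X z)) \<le> (\<Sum>b :: 'n \<Rightarrow>\<^sub>0 nat | monom_degree b = d. e * 1)"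
        unfolding form_eval_def by (intro sum_norm_le) auto
      also have "\<dots> = real N / (real N + 1) / 4"
        by (simp add: N_def e_def)
      also have "\<dots> \<le> 1 / 4" by (intro divide_right_mono) auto
      finally show ?thesis .
    qed
    have "\<exists>z\<in>K. T z = z"
    proof (rule brouwer)
      have "bounded K"
        unfolding bounded_iff
      proof (intro exI ballI)
        fix z assume "z \<in> K"
        have "norm z \<le> (\<Sum>i\<in>UNIV. norm (z $ i))"
          unfolding norm_vec_def by (rule L2_set_le_sum) auto
        also have "\<dots> \<le> (\<Sum>i\<in>(UNIV :: 'n set). 1 / 2)"
          using \<open>z \<in> K\<close> by (intro sum_mono) (auto simp: K_def)
        finally show "norm z \<le> (\<Sum>i\<in>(UNIV :: 'n set). 1 / 2)" .
      qed
      moreover have "closed K"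
        unfolding K_def by (intro closed_Collect_all closed_Collect_le continuous_intros)
      ultimately show "compact K" by (simp add: compact_eq_bounded_closed)
      show "convex K"
      proof (rule convexI)
        fix x y :: "complex ^ 'n" and u v :: real
        assume xy: "x \<in> K" "y \<in> K" "0 \<le> u" "0 \<le> v" "u + v = 1"
        have "norm ((u *\<^sub>R x + v *\<^sub>R y) $ i) \<le> 1 / 2" for i
        proof -
          have "norm ((u *\<^sub>R x + v *\<^sub>R y) $ i) \<le> u * norm (x $ i) + v * norm (y $ i)"
            using xy by (auto intro: order.trans[OF norm_triangle_ineq])
          also have "\<dots> \<le> u * (1 / 2) + v * (1 / 2)"
            using xy by (intro add_mono mult_left_mono) (auto simp: K_def)
          finally show ?thesis using xy by (simp flip: distrib_right)
        qed
        then show "u *\<^sub>R x + v *\<^sub>R y \<in> K" by (simp add: K_def)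
      qed
      have "0 \<in> K" by (simp add: K_def)
      then show "K \<noteq> {}" by auto
      have X_cont: "continuous_on K (\<lambda>z. X z i)" for i
        unfolding X_def by (cases "i = n") (auto intro!: continuous_intros)
      show "continuous_on K T"
        unfolding T_def form_eval_def monom_eval_def by (intro continuous_intros X_cont)
      show "T \<in> K \<rightarrow> K"
      proof
        fix z assume z: "z \<in> K"
        have "norm (T z $ i) \<le> 1 / 2" for i
        proof (cases "i = n")
          case True
          then have "T z $ i = - form_eval d \<delta> i (X z)"
            by (simp add: T_def form_c form_c0) (simp add: X_def)
          then show ?thesis using form_\<delta>[OF z, of i] by simp
        next
          case False
          then have "T z $ i = - form_eval d \<delta> i (X z) - z $ n * (z $ i) ^ d"
            by (simp add: T_def form_c form_c0) (simp add: X_def)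
          also have "norm \<dots> \<le> norm (form_eval d \<delta> i (X z)) + norm (z $ n) * norm (z $ i) ^ d"
            using norm_triangle_ineq4[of "- form_eval d \<delta> i (X z)" "z $ n * (z $ i) ^ d"]
            by (simp add: norm_mult norm_power)
          also have "norm (z $ i) ^ d \<le> (1 / 2) ^ d"
            using z by (intro power_mono) (auto simp: K_def)
          also have "(1 / 2 :: real) ^ d \<le> (1 / 2) ^ 1"
            using d by (intro power_decreasing) auto
          finally have "norm (T z $ i) \<le> norm (form_eval d \<delta> i (X z)) + norm (z $ n) * (1 / 2)"
            by (simp add: mult_left_mono)
          also have "\<dots> \<le> 1 / 4 + 1 / 2 * (1 / 2)"
            using form_\<delta>[OF z, of i] z by (intro add_mono mult_right_mono) (auto simp: K_def)
          finally show ?thesis by simp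
        qed
        then show "T z \<in> K" by (simp add: K_def)
      qed
    qed blast
    then obtain z where "T z = z" by blast
    then have z: "form_eval d c i (X z) + z $ n * X z i ^ d = 0" for i
      by (auto simp: T_def vec_eq_iff algebra_simps add_eq_0_iff dest: spec[of _ i])
    have "X z \<noteq> (\<lambda>_. 0)"
      by (auto simp: X_def fun_eq_iff intro!: exI[of _ n])
    moreover have "form_eval d (\<lambda>v. c v + z $ n * system_coeffs (pure_powers d) v) i (X z) = 0" for i
      using form_eval_add_scaled[of d 1 c "z $ n" "system_coeffs (pure_powers d)" i "X z"] z
      by (simp add: form_eval_pure_powers)
    ultimately show "f c = 0"
      by (intro zero[of c "z $ n"]) (auto simp: singular_systems_def)
  qed
qed

text \<open>The singular systems are closed under scaling, so each homogeneous component of a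
  polynomial vanishing on them vanishes there too. A component of degree \<open>m\<close> that is
  nonzero at \<open>G\<close> has this value as its coefficient at \<open>t ^ m\<close> on every
  line in direction \<open>G\<close>, and is divided by it.\<close>

lemma singular_systems_monic_family:
  assumes d: "d > 0"
  defines "G \<equiv> system_coeffs (pure_powers d) :: 'n::finite \<times> ('n \<Rightarrow>\<^sub>0 nat) \<Rightarrow> complex"
  obtains p m where "p \<in> polyfams" "\<And>c. degree (p c) \<le> m" "\<And>c. coeff (p c) m = 1"
    "\<And>c t. (\<lambda>v. c v + t * G v) \<in> singular_systems d \<Longrightarrow> poly (p c) t = 0"
proof -
  obtain P where P: "P \<in> polyfuns" "P G = 1" "\<And>z. z \<in> singular_systems d \<Longrightarrow> P z = 0"
    using nonsingular_separation[OF pure_powers_nonsingular[OF d]] unfolding G_def by blast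
  from P(1) obtain A k where A: "finite A" and P_eq: "P = (\<lambda>x. \<Sum>a\<in>A. k a * monom_eval a x)"
    by (rule polyfuns_obtain)
  \<comment> \<open>The coefficients of \<open>q c\<close> are the values at \<open>c\<close> of the
    homogeneous components of \<open>P\<close>.\<close>
  define q where "q c = (\<Sum>a\<in>A. monom (k a * monom_eval a c) (monom_degree a))" for c
  have poly_q: "poly (q c) s = P (\<lambda>v. s * c v)" for c s
    by (simp add: q_def P_eq poly_sum poly_monom monom_eval_scale mult_ac)
  have coeff_q: "coeff (q c) m = (\<Sum>a | a \<in> A \<and> monom_degree a = m. k a * monom_eval a c)" for c m
    using A by (simp add: q_def coeff_sum sum.If_cases Int_def)
  have q_singular: "q c = 0" if "c \<in> singular_systems d" for c
    using P(3)[OF singular_systems_scale[OF that]]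
    by (simp add: poly_eq_poly_eq_iff[symmetric] fun_eq_iff poly_q)
  have "q G \<noteq> 0" using poly_q[of G 1] P(2) by auto
  then obtain m where m: "coeff (q G) m \<noteq> 0" by (meson leading_coeff_0_iff)
  let ?A = "{a \<in> A. monom_degree a = m}"
  obtain p where p: "p \<in> polyfams"
    "\<And>c s. poly (p c) s = (\<Sum>a\<in>?A. k a * monom_eval a (\<lambda>w. c w + s * G w))"
    "\<And>c. degree (p c) \<le> m"
    "\<And>c. coeff (p c) m = (\<Sum>a | a \<in> ?A \<and> monom_degree a = m. k a * monom_eval a G)"
    using polyfams_expand_graded[of ?A m k G] A by auto
  have p_m: "coeff (p c) m = coeff (q G) m" for c
    unfolding p(4) coeff_q by (intro sum.cong) auto
  show ?thesis
  proof (rule that[of "\<lambda>c. smult (1 / coeff (q G) m) (p c)" m])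
    show "(\<lambda>c. smult (1 / coeff (q G) m) (p c)) \<in> polyfams"
      by (intro polyfams_smult polyfuns_const p)
    show "degree (smult (1 / coeff (q G) m) (p c)) \<le> m" for c
      using p(3)[of c] by simp
    show "coeff (smult (1 / coeff (q G) m) (p c)) m = 1" for c
      using m by (simp add: p_m)
    show "poly (smult (1 / coeff (q G) m) (p c)) t = 0"
      if "(\<lambda>v. c v + t * G v) \<in> singular_systems d" for c t
      using q_singular[OF that] coeff_q[of "\<lambda>v. c v + t * G v" m] by (simp add: p(2))
  qed
qed

text \<open>\<open>R\<close> generates the vanishing ideal. At a nonsingular system some multiple of
  \<open>R\<close> has the value 1, so \<open>R\<close> has no further zeros.\<close>

lemma singular_systems_hypersurface:
  assumes d: "d > 0"
  obtains R :: "('n::finite \<times> ('n \<Rightarrow>\<^sub>0 nat) \<Rightarrow> complex) \<Rightarrow> complex"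
  where "R \<in> polyfuns" "\<And>c. R c = 0 \<longleftrightarrow> c \<in> singular_systems d"
    "\<And>f. f \<in> polyfuns \<Longrightarrow> \<forall>c\<in>singular_systems d. f c = 0 \<Longrightarrow> \<exists>q\<in>polyfuns. \<forall>c. f c = q c * R c"
proof -
  let ?G = "system_coeffs (pure_powers d) :: 'n \<times> ('n \<Rightarrow>\<^sub>0 nat) \<Rightarrow> complex"
  obtain p m where p: "p \<in> polyfams" "\<And>c. degree (p c) \<le> m" "\<And>c. coeff (p c) m = 1"
    "\<And>c t. (\<lambda>v. c v + t * ?G v) \<in> singular_systems d \<Longrightarrow> poly (p c) t = 0"
    by (rule singular_systems_monic_family[OF d]) blast
  obtain R :: "('n \<times> ('n \<Rightarrow>\<^sub>0 nat) \<Rightarrow> complex) \<Rightarrow> complex" where R: "R \<in> polyfuns"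
    "\<And>c. c \<in> singular_systems d \<Longrightarrow> R c = 0"
    "\<And>f. f \<in> polyfuns \<Longrightarrow> \<forall>c\<in>singular_systems d. f c = 0 \<Longrightarrow> \<exists>q\<in>polyfuns. \<forall>c. f c = q c * R c"
  proof (rule vanishing_ideal_principal[where Z = "singular_systems d" and G = ?G and ?p0.0 = p and D = m])
    fix f :: "('n \<times> ('n \<Rightarrow>\<^sub>0 nat) \<Rightarrow> complex) \<Rightarrow> complex" and c
    assume "f \<in> polyfuns" "\<And>c t. (\<lambda>v. c v + t * ?G v) \<in> singular_systems d \<Longrightarrow> f c = 0"
    then show "f c = 0" by (rule singular_systems_plus_pure_powers_dense[OF d])
  next
    fix f g :: "('n \<times> ('n \<Rightarrow>\<^sub>0 nat) \<Rightarrow> complex) \<Rightarrow> complex"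
    assume "f \<in> polyfuns" "g \<in> polyfuns" "\<forall>c\<in>singular_systems d. f c * g c = 0"
    then show "(\<forall>c\<in>singular_systems d. f c = 0) \<or> (\<forall>c\<in>singular_systems d. g c = 0)"
      by (rule singular_systems_prime[OF d])
  qed (use p in blast)+
  have "c \<in> singular_systems d" if "R c = 0" for c
  proof (rule ccontr)
    assume "c \<notin> singular_systems d"
    then obtain P where P: "P \<in> polyfuns" "P c = 1" "\<forall>z\<in>singular_systems d. P z = 0"
      using nonsingular_separation by blast
    from R(3)[OF P(1,3)] obtain q where "P c = q c * R c" by blast
    with P(2) that show False by simp
  qed
  then show ?thesis using R by (intro that[of R]) blast+
qed

text \<open>Setting the indeterminates outside \<open>E\<close> to 0 deletes the monomials
  containing them. This removes coefficients of other degrees from the resultant.\<close>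

lemma poly_eval_restrict_vars:
  obtains Q where "poly_vars Q \<subseteq> E" "\<And>c. poly_eval Q c = poly_eval P (\<lambda>v. if v \<in> E then c v else 0)"
proof -
  define A where "A = {a \<in> Poly_Mapping.keys P. Poly_Mapping.keys a \<subseteq> E}"
  define Q where "Q = (\<Sum>a\<in>A. Poly_Mapping.single a (Poly_Mapping.lookup P a))"
  have [simp]: "finite A" by (simp add: A_def)
  have "Poly_Mapping.lookup Q a = (if a \<in> A then Poly_Mapping.lookup P a else 0)" for a
    by (simp add: Q_def lookup_sum lookup_single when_def)
  then have "Poly_Mapping.keys Q \<subseteq> A" by (auto simp: in_keys_iff split: if_splits)
  then have "poly_vars Q \<subseteq> E" by (auto simp: poly_vars_def A_def)
  moreover have "poly_eval Q c = poly_eval P (\<lambda>v. if v \<in> E then c v else 0)" for c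
  proof -
    have "monom_eval a (\<lambda>v. if v \<in> E then c v else 0)
        = (if Poly_Mapping.keys a \<subseteq> E then monom_eval a c else 0)" for a
      unfolding monom_eval_def by (auto simp: subset_iff in_keys_iff intro!: prod.cong prod_zero)
    then show ?thesis
      by (simp add: Q_def poly_eval_sum poly_eval_monoms[of P] A_def sum.If_cases Int_def
          if_distrib[of "\<lambda>y. _ * y"] cong: if_cong)
  qed
  ultimately show ?thesis by (rule that)
qed

section \<open>From coefficient families to systems of polynomials\<close>

lemma form_eval_system_coeffs:
  fixes F :: "'n::finite \<Rightarrow> 'n cpoly"
  assumes "homogeneous d (F i)"
  shows "form_eval d (system_coeffs F) i x = poly_eval (F i) x"
  using assms
  by (subst poly_eval_superset[where A = "{b. monom_degree b = d}"])
    (auto simp: homogeneous_def form_eval_def system_coeffs_def)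

lemma singular_system_coeffs_iff:
  fixes F :: "'n::finite \<Rightarrow> 'n cpoly"
  assumes "\<And>i. homogeneous d (F i)"
  shows "system_coeffs F \<in> singular_systems d \<longleftrightarrow>
    (\<exists>x :: complex ^ 'n. x \<noteq> 0 \<and> (\<forall>i. poly_eval (F i) (($) x) = 0))"
proof -
  have "system_coeffs F \<in> singular_systems d \<longleftrightarrow> (\<exists>x. x \<noteq> (\<lambda>_. 0) \<and> (\<forall>i. poly_eval (F i) x = 0))"
    using assms by (simp add: singular_systems_def form_eval_system_coeffs)
  also have "\<dots> \<longleftrightarrow> (\<exists>x :: complex ^ 'n. x \<noteq> 0 \<and> (\<forall>i. poly_eval (F i) (($) x) = 0))"
  proof
    assume "\<exists>x. x \<noteq> (\<lambda>_. 0) \<and> (\<forall>i. poly_eval (F i) x = 0)"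
    then obtain x where "x \<noteq> (\<lambda>_. 0)" "\<forall>i. poly_eval (F i) x = 0" by blast
    then show "\<exists>x :: complex ^ 'n. x \<noteq> 0 \<and> (\<forall>i. poly_eval (F i) (($) x) = 0)"
      by (intro exI[of _ "\<chi> i. x i"]) (auto simp: vec_eq_iff fun_eq_iff vec_lambda_inverse)
  next
    assume "\<exists>x :: complex ^ 'n. x \<noteq> 0 \<and> (\<forall>i. poly_eval (F i) (($) x) = 0)"
    then show "\<exists>x. x \<noteq> (\<lambda>_. 0) \<and> (\<forall>i. poly_eval (F i) x = 0)"
      by (metis (mono_tags) vec_eq_iff zero_index)
  qed
  finally show ?thesis .
qed

text \<open>The normalized generator of the vanishing ideal of the singular systems serves; it is
  irreducible because this ideal is prime.\<close>

lemma resultant_exists: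
  assumes d: "d > 0"
  shows "\<exists>R :: ('n::finite \<times> ('n \<Rightarrow>\<^sub>0 nat)) cpoly. is_resultant_poly d R"
proof -
  let ?E = "{(i :: 'n, a :: 'n \<Rightarrow>\<^sub>0 nat). monom_degree a = d}"
  let ?G = "system_coeffs (pure_powers d) :: 'n \<times> ('n \<Rightarrow>\<^sub>0 nat) \<Rightarrow> complex"
  obtain R0 :: "('n \<times> ('n \<Rightarrow>\<^sub>0 nat) \<Rightarrow> complex) \<Rightarrow> complex" where R0: "R0 \<in> polyfuns"
    "\<And>c. R0 c = 0 \<longleftrightarrow> c \<in> singular_systems d"
    "\<And>f. f \<in> polyfuns \<Longrightarrow> \<forall>c\<in>singular_systems d. f c = 0 \<Longrightarrow> \<exists>q\<in>polyfuns. \<forall>c. f c = q c * R0 c"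
    using singular_systems_hypersurface[OF d] by blast
  have G: "R0 ?G \<noteq> 0" using pure_powers_nonsingular[OF d] by (simp add: R0)
  have "(\<lambda>c. 1 / R0 ?G * R0 c) \<in> polyfuns"
    by (intro polyfuns_mult polyfuns_const R0)
  then obtain P where P: "poly_eval P = (\<lambda>c. 1 / R0 ?G * R0 c)"
    unfolding polyfuns_def by auto
  obtain R where R_vars: "poly_vars R \<subseteq> ?E"
    and R_P: "\<And>c. poly_eval R c = poly_eval P (\<lambda>v. if v \<in> ?E then c v else 0)"
    using poly_eval_restrict_vars[of ?E P] by blast
  \<comment> \<open>Restricting the variables must not change the values. A nonsingular
    \<open>c\<close> is joined to \<open>c'\<close> by a line of systems with the same forms, on
    which \<open>R0\<close> has no zero and is therefore constant.\<close>
  have R0_cong: "R0 c = R0 c'" if eq: "\<And>v. v \<in> ?E \<Longrightarrow> c v = c' v" for c c'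
  proof -
    have singular_cong: "c \<in> singular_systems d \<longleftrightarrow> c' \<in> singular_systems d"
      if "\<And>v. v \<in> ?E \<Longrightarrow> c v = c' v" for c c' :: "'n \<times> ('n \<Rightarrow>\<^sub>0 nat) \<Rightarrow> complex"
    proof -
      have "form_eval d c = form_eval d c'"
        using that by (intro ext form_eval_cong) auto
      then show ?thesis by (simp add: singular_systems_def)
    qed
    show ?thesis
    proof (cases "c \<in> singular_systems d")
      case True
      moreover have "c' \<in> singular_systems d"
        using singular_cong[of c c'] eq True by blast
      ultimately have "R0 c = 0" "R0 c' = 0" by (simp_all add: R0(2))
      then show ?thesis by simp
    next
      case False
      have "(\<lambda>v. c v + s * (c' v - c v)) \<notin> singular_systems d" for s
        using singular_cong[of "\<lambda>v. c v + s * (c' v - c v)" c] eq False by simp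
      then have "R0 (\<lambda>v. c v + s * (c' v - c v)) \<noteq> 0" for s
        by (simp add: R0(2))
      then have "R0 (\<lambda>v. c v + 0 * (c' v - c v)) = R0 (\<lambda>v. c v + 1 * (c' v - c v))"
        by (intro range_poly_nonzero_const[where f = "\<lambda>s. R0 (\<lambda>v. c v + s * (c' v - c v))"]
            polyfuns_line R0(1))
      then show ?thesis by simp
    qed
  qed
  have R: "poly_eval R c = 1 / R0 ?G * R0 c" for c
    unfolding R_P P by (subst R0_cong[of _ c]) auto
  have R_zero: "poly_eval R c = 0 \<longleftrightarrow> c \<in> singular_systems d" for c
    using G by (simp add: R R0)
  \<comment> \<open>Such an \<open>A\<close> is a multiple of \<open>R0\<close>, and cancelling
    \<open>R0\<close> in \<open>R = A * B\<close> exhibits an inverse of \<open>B\<close>.\<close>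
  have unit_factor: "B dvd 1" if AB: "R = A * B" and A: "\<forall>c\<in>singular_systems d. poly_eval A c = 0" for A B
  proof -
    have "poly_eval A \<in> polyfuns" by (simp add: polyfuns_def)
    with A obtain q where q: "q \<in> polyfuns" "\<forall>c. poly_eval A c = q c * R0 c"
      using R0(3) by blast
    from q(1) obtain Q where Q: "q = poly_eval Q" by (auto simp: polyfuns_def)
    let ?C = "Poly_Mapping.single 0 (R0 ?G) * Q * B"
    have "poly_eval ?C c = poly_eval 1 c" for c
    proof (rule polyfuns_mult_cancel[of "poly_eval ?C" "poly_eval 1" R0 ?G])
      fix c
      have "1 / R0 ?G * R0 c = q c * R0 c * poly_eval B c"
        using R[of c] q(2) unfolding AB poly_eval_mult by simp
      then show "poly_eval ?C c * R0 c = poly_eval 1 c * R0 c"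
        using G by (simp add: poly_eval_mult Q field_simps)
    qed (use G R0(1) in \<open>auto simp: polyfuns_def\<close>)
    then have "?C = 1" by (rule poly_eval_eqI)
    then show ?thesis by (metis dvd_triv_right)
  qed
  have "irreducible R"
  proof (rule irreducibleI)
    show "R \<noteq> 0" using R[of ?G] G by auto
    show "\<not> R dvd 1"
    proof
      assume "R dvd 1"
      then obtain B where "1 = R * B" by blast
      moreover have "(\<lambda>_. 0) \<in> (singular_systems d :: ('n \<times> _ \<Rightarrow> _) set)"
        by (auto simp: singular_systems_def form_eval_def fun_eq_iff intro!: exI[of _ "\<lambda>_. 1"])
      ultimately show False
        using R_zero[of "\<lambda>_. 0"] by (metis mult_zero_left poly_eval_mult poly_eval_one zero_neq_one)
    qed
    fix A B assume AB: "R = A * B"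
    then have "\<forall>c\<in>singular_systems d. poly_eval A c * poly_eval B c = 0"
      using R_zero by (simp add: poly_eval_mult)
    then have "(\<forall>c\<in>singular_systems d. poly_eval A c = 0) \<or> (\<forall>c\<in>singular_systems d. poly_eval B c = 0)"
      by (intro singular_systems_prime[OF d]) (auto simp: polyfuns_def)
    then show "A dvd 1 \<or> B dvd 1"
      using unit_factor[of A B] unit_factor[of B A] AB by (auto simp: mult.commute)
  qed
  then have "is_resultant_poly d R"
    unfolding is_resultant_poly_def using R_vars R_zero G by (simp add: singular_system_coeffs_iff R)
  then show ?thesis by blast
qed

lemma Res_eq_0_iff:
  fixes F :: "'n::finite \<Rightarrow> 'n cpoly"
  assumes "d > 0" "\<And>i. homogeneous d (F i)"
  shows "Res d F = 0 \<longleftrightarrow> system_coeffs F \<in> singular_systems d"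
proof -
  have "is_resultant_poly d (resultant_poly d :: ('n \<times> ('n \<Rightarrow>\<^sub>0 nat)) cpoly)"
    unfolding resultant_poly_def using resultant_exists[OF assms(1)] by (rule someI_ex)
  with assms(2) show ?thesis
    by (simp add: is_resultant_poly_def Res_def singular_system_coeffs_iff)
qed

section \<open>Systems with a vanishing form\<close>

text \<open>Multiplying one form of the system by a factor \<open>s \<noteq> 0\<close> multiplies the resultant by a constant,
  which is \<open>0\<close> for \<open>s = 0\<close> because \<open>s = 0\<close> makes the system of pure powers singular.\<close>

lemma zero_form_singular:
  fixes c :: "'n::finite \<times> ('n \<Rightarrow>\<^sub>0 nat) \<Rightarrow> complex"
  assumes d: "d > 0" and zero: "\<And>b. c (k, b) = 0"
  shows "c \<in> singular_systems d"
proof -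
  let ?G = "system_coeffs (pure_powers d) :: 'n \<times> ('n \<Rightarrow>\<^sub>0 nat) \<Rightarrow> complex"
  obtain R :: "('n \<times> ('n \<Rightarrow>\<^sub>0 nat) \<Rightarrow> complex) \<Rightarrow> complex" where R: "R \<in> polyfuns"
    "\<And>c. R c = 0 \<longleftrightarrow> c \<in> singular_systems d"
    "\<And>f. f \<in> polyfuns \<Longrightarrow> \<forall>c\<in>singular_systems d. f c = 0 \<Longrightarrow> \<exists>q\<in>polyfuns. \<forall>c. f c = q c * R c"
    using singular_systems_hypersurface[OF d] by blast
  have G: "R ?G \<noteq> 0" using pure_powers_nonsingular[OF d] by (simp add: R(2))
  define scale where "scale s c v = (if fst v = k then s * c v else c v)"
    for s and c :: "'n \<times> ('n \<Rightarrow>\<^sub>0 nat) \<Rightarrow> complex" and v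
  have form_scale: "form_eval d (scale s c) i x = (if i = k then s * form_eval d c i x else form_eval d c i x)"
    for s c i x
    by (simp add: form_eval_def scale_def sum_distrib_left mult.assoc)
  have scale_scale: "scale (1 / s) (scale s c) = c" if "s \<noteq> 0" for s c
    using that by (auto simp: scale_def)
  have scale_singular: "scale s c \<in> singular_systems d" if "c \<in> singular_systems d" for s c
  proof -
    from that obtain x where "x \<noteq> (\<lambda>_. 0)" "\<And>i. form_eval d c i x = 0"
      by (auto simp: singular_systems_def)
    then show ?thesis
      unfolding singular_systems_def by (auto simp: form_scale)
  qed
  have poly_scale: "(\<lambda>c. f (scale s c)) \<in> polyfuns" if "f \<in> polyfuns" for f s
    using that
  proof (rule polyfuns_compose)
    show "(\<lambda>c. scale s c v) \<in> polyfuns" for v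
      unfolding scale_def by (intro polyfuns_if polyfuns_mult polyfuns_const polyfuns_var)
  qed
  have factor: "\<exists>q\<in>polyfuns. \<forall>c. R (scale s c) = q c * R c" for s
    using R(2) scale_singular by (intro R(3) poly_scale R(1)) simp
  \<comment> \<open>Scaling back by \<open>1 / s\<close> shows that the quotient \<open>q\<close>
    has no zero, so it is constant and can be read off at \<open>?G\<close>.\<close>
  have ratio: "R (scale s c) * R ?G = R (scale s ?G) * R c" if "s \<noteq> 0" for s c
  proof -
    obtain q where q: "q \<in> polyfuns" "\<And>c. R (scale s c) = q c * R c"
      using factor[of s] by blast
    obtain q' where q': "q' \<in> polyfuns" "\<And>c. R (scale (1 / s) c) = q' c * R c"
      using factor[of "1 / s"] by blast
    have "(\<lambda>c. q' (scale s c) * q c) \<in> polyfuns"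
      by (rule polyfuns_mult[OF poly_scale[OF q'(1)] q(1)])
    moreover have "q' (scale s c) * q c * R c = 1 * R c" for c
      using q'(2)[of "scale s c"] q(2)[of c] scale_scale[OF that, of c] by simp
    ultimately have "q' (scale s c) * q c = 1" for c
      by (rule polyfuns_mult_cancel[OF _ polyfuns_const R(1) G])
    then have "q c \<noteq> 0" for c by (metis mult_zero_right zero_neq_one)
    then have "q c = q ?G" by (rule polyfuns_nonzero_const[OF q(1)])
    then show ?thesis by (simp add: q(2))
  qed
  have curve: "(\<lambda>s. R (scale s c)) \<in> range poly" for c
    using R(1)
  proof (rule polyfuns_curve)
    show "(\<lambda>s. scale s c v) \<in> range poly" for v
      unfolding scale_def
      by (cases "fst v = k") (simp_all add: range_poly_mult del: image_iff)
  qed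
  have "R (scale 0 c) * R ?G - R (scale 0 ?G) * R c = 0"
  proof (rule range_poly_eq_zero[where f = "\<lambda>s. R (scale s c) * R ?G - R (scale s ?G) * R c"])
    show "(\<lambda>s. R (scale s c) * R ?G - R (scale s ?G) * R c) \<in> range poly"
      by (intro range_poly_diff range_poly_mult curve range_poly_const)
    have "UNIV - {0} \<subseteq> {s. R (scale s c) * R ?G - R (scale s ?G) * R c = 0}"
      using ratio by auto
    then show "infinite {s. R (scale s c) * R ?G - R (scale s ?G) * R c = 0}"
      by (rule infinite_super) (rule infinite_remove[OF infinite_UNIV_char_0])
  qed
  \<comment> \<open>Without the pure power of \<open>k\<close>, the unit vector of index
    \<open>k\<close> is a zero.\<close>
  moreover have "scale 0 ?G \<in> singular_systems d"
    unfolding singular_systems_def using d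
    by (auto simp: form_scale form_eval_pure_powers fun_eq_iff power_0_left
        intro!: exI[of _ "\<lambda>i. if i = k then 1 else 0"])
  then have "R (scale 0 ?G) = 0" by (simp only: R(2))
  ultimately have "R (scale 0 c) = 0" using G by simp
  then have "scale 0 c \<in> singular_systems d" by (simp only: R(2))
  moreover have "scale 0 c = c" using zero by (auto simp: scale_def)
  ultimately show ?thesis by simp
qed

lemma nonsingular_system_surjective:
  fixes c :: "'n::finite \<times> ('n \<Rightarrow>\<^sub>0 nat) \<Rightarrow> complex"
  assumes d: "d > 0" and c: "c \<notin> singular_systems d"
  shows "\<exists>x. \<forall>i. form_eval d c i x = y i"
proof (cases "y = (\<lambda>_. 0)")
  case True
  then show ?thesis by (intro exI[of _ "\<lambda>_. 0"]) (simp add: form_eval_zero[OF d])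
next
  case False
  then obtain k where k: "y k \<noteq> 0" by auto
  define c' where "c' v = (if fst v = k then 0 else c v - y (fst v) / y k * c (k, snd v))" for v
  have "c' \<in> singular_systems d"
    by (rule zero_form_singular[OF d, of _ k]) (simp add: c'_def)
  then obtain x where x: "x \<noteq> (\<lambda>_. 0)" "\<And>i. form_eval d c' i x = 0"
    by (auto simp: singular_systems_def)
  have proportional: "form_eval d c i x = y i / y k * form_eval d c k x" for i
  proof (cases "i = k")
    case False
    then have "form_eval d c' i x = form_eval d c i x - y i / y k * form_eval d c k x"
      by (simp add: form_eval_def c'_def sum_subtractf left_diff_distrib sum_distrib_left mult.assoc)
    with x(2) show ?thesis by simp
  qed (use k in simp)
  have "form_eval d c k x \<noteq> 0"
  proof
    assume "form_eval d c k x = 0"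
    with proportional have "c \<in> singular_systems d"
      using x(1) by (auto simp: singular_systems_def)
    with c show False by simp
  qed
  \<comment> \<open>Scaling \<open>x\<close> by \<open>\<mu>\<close> multiplies every form by
    \<open>\<mu> ^ d\<close>, so a complex root turns proportionality to \<open>y\<close> into
    equality.\<close>
  moreover obtain \<mu> where "y k / form_eval d c k x = \<mu> ^ d"
    using exists_complex_root[of d "y k / form_eval d c k x"] d by auto
  ultimately have "form_eval d c i (\<lambda>j. \<mu> * x j) = y i" for i
    using k by (simp add: form_eval_scale proportional[of i] flip: \<open>y k / form_eval d c k x = \<mu> ^ d\<close>)
  then show ?thesis by blast
qed

section \<open>Tensors\<close>

definition tensor_apply :: "nat \<Rightarrow> 'n::finite tensor \<Rightarrow> ('n \<Rightarrow> complex) \<Rightarrow> 'n \<Rightarrow> complex" where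
  "tensor_apply m T x i = (\<Sum>J | length J = m - 1. T (i # J) * (\<Prod>j\<leftarrow>J. x j))"

lemma monom_eval_sum_list: "monom_eval (\<Sum>j\<leftarrow>J. Poly_Mapping.single j 1) x = (\<Prod>j\<leftarrow>J. x j)"
  by (induction J) (simp_all add: monom_eval_add)

lemma monom_degree_sum_list: "monom_degree (\<Sum>j\<leftarrow>J. Poly_Mapping.single j 1) = length J"
  by (induction J) (simp_all add: monom_degree_add)

lemma tensor_form_homogeneous: "homogeneous (m - 1) (tensor_form m T i)"
  unfolding homogeneous_def
proof
  fix a assume "a \<in> Poly_Mapping.keys (tensor_form m T i)"
  then have "Poly_Mapping.lookup (tensor_form m T i) a \<noteq> 0" by (simp add: in_keys_iff)
  then have "\<exists>J. length J = m - 1 \<and> (\<Sum>j\<leftarrow>J. Poly_Mapping.single j 1) = a"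
    unfolding tensor_form_def lookup_sum lookup_single
    by (auto simp: when_def split: if_splits elim!: sum.not_neutral_contains_not_neutral)
  then show "monom_degree a = m - 1" by (metis monom_degree_sum_list)
qed

lemma form_eval_tensor_form:
  "form_eval (m - 1) (system_coeffs (tensor_form m T)) i x = tensor_apply m T x i"
  unfolding form_eval_system_coeffs[OF tensor_form_homogeneous]
  unfolding tensor_form_def tensor_apply_def poly_eval_sum poly_eval_single monom_eval_sum_list ..

lemma Edet_eq_0_iff_singular:
  "m \<ge> 2 \<Longrightarrow> Edet m T = 0 \<longleftrightarrow> system_coeffs (tensor_form m T) \<in> singular_systems (m - 1)"
  unfolding Edet_def by (intro Res_eq_0_iff tensor_form_homogeneous) simp

lemma Edet_eq_0_iff:
  "m \<ge> 2 \<Longrightarrow> Edet m T = 0 \<longleftrightarrow> (\<exists>x. x \<noteq> (\<lambda>_. 0) \<and> tensor_apply m T x = (\<lambda>_. 0))"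
  unfolding Edet_eq_0_iff_singular singular_systems_def mem_Collect_eq form_eval_tensor_form
  by (simp add: fun_eq_iff)

lemma tensor_apply_zero:
  assumes "m \<ge> 2"
  shows "tensor_apply m T (\<lambda>_. 0) i = 0"
  unfolding form_eval_tensor_form[symmetric] using assms by (intro form_eval_zero) simp

lemma sum_lists_length_add:
  "(\<Sum>L | length L = r + s. f L) = (\<Sum>A | length A = r. \<Sum>B | length B = s. f (A @ B))"
proof -
  have "(\<Sum>L | length L = r + s. f L) = (\<Sum>(A, B)\<in>{A. length A = r} \<times> {B. length B = s}. f (A @ B))"
    by (rule sum.reindex_bij_witness[of _ "\<lambda>(A, B). A @ B" "\<lambda>L. (take r L, drop r L)"]) auto
  then show ?thesis by (simp add: sum.cartesian_product)
qed

text \<open>A list of length \<open>P * r\<close> is a sequence of \<open>P\<close> blocks of length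
  \<open>r\<close>, so this is the distributive law. The induction splits off the first
  block.\<close>

lemma sum_lists_blocks:
  fixes g :: "nat \<Rightarrow> 'n::finite list \<Rightarrow> complex"
  shows "(\<Sum>L | length L = P * r. (\<Prod>k<P. g k (take r (drop (k * r) L))) * (\<Prod>j\<leftarrow>L. x j))
    = (\<Prod>k<P. \<Sum>J | length J = r. g k J * (\<Prod>j\<leftarrow>J. x j))"
proof (induction P arbitrary: g)
  case 0
  then show ?case by simp
next
  case (Suc P)
  have "(\<Sum>L | length L = Suc P * r. (\<Prod>k<Suc P. g k (take r (drop (k * r) L))) * (\<Prod>j\<leftarrow>L. x j))
    = (\<Sum>A | length A = r. \<Sum>B | length B = P * r.
        (\<Prod>k<Suc P. g k (take r (drop (k * r) (A @ B)))) * (\<Prod>j\<leftarrow>A @ B. x j))"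
    unfolding mult_Suc by (rule sum_lists_length_add)
  also have "\<dots> = (\<Sum>A | length A = r. \<Sum>B | length B = P * r. (g 0 A * (\<Prod>j\<leftarrow>A. x j)) *
        ((\<Prod>k<P. g (Suc k) (take r (drop (k * r) B))) * (\<Prod>j\<leftarrow>B. x j)))"
    by (intro sum.cong refl) (simp add: prod.lessThan_Suc_shift del: prod.lessThan_Suc)
  also have "\<dots> = (\<Sum>A | length A = r. g 0 A * (\<Prod>j\<leftarrow>A. x j)) *
      (\<Sum>B | length B = P * r. (\<Prod>k<P. g (Suc k) (take r (drop (k * r) B))) * (\<Prod>j\<leftarrow>B. x j))"
    by (simp add: sum_product)
  also have "\<dots> = (\<Prod>k<Suc P. \<Sum>J | length J = r. g k J * (\<Prod>j\<leftarrow>J. x j))"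
    by (simp only: Suc.IH[of "\<lambda>k. g (Suc k)"] prod.lessThan_Suc_shift)
  finally show ?case .
qed

text \<open>For fixed \<open>I\<close>, the sum over concatenated index lists factors into one sum
  per block, and block \<open>k\<close> yields the component \<open>I ! k\<close> of the inner
  map.\<close>

lemma tensor_apply_comp:
  "tensor_apply (1 + (p - 1) * (q - 1)) (tensor_comp p q U V) x = tensor_apply p U (tensor_apply q V x)"
proof
  fix i
  have "tensor_apply (1 + (p - 1) * (q - 1)) (tensor_comp p q U V) x i
      = (\<Sum>L | length L = (p - 1) * (q - 1). \<Sum>I | length I = p - 1. U (i # I) *
          ((\<Prod>k<p - 1. V (I ! k # take (q - 1) (drop (k * (q - 1)) L))) * (\<Prod>j\<leftarrow>L. x j)))"
    by (simp add: tensor_apply_def tensor_comp_def index_block_def sum_distrib_right mult.assoc)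
  also have "\<dots> = (\<Sum>I | length I = p - 1. U (i # I) * (\<Sum>L | length L = (p - 1) * (q - 1).
          (\<Prod>k<p - 1. V (I ! k # take (q - 1) (drop (k * (q - 1)) L))) * (\<Prod>j\<leftarrow>L. x j)))"
    by (subst sum.swap) (simp add: sum_distrib_left)
  also have "\<dots> = (\<Sum>I | length I = p - 1. U (i # I) * (\<Prod>k<p - 1. tensor_apply q V x (I ! k)))"
    unfolding tensor_apply_def
    using sum_lists_blocks[where g = "\<lambda>k J. V (I ! k # J)" for I] by simp
  also have "\<dots> = tensor_apply p U (tensor_apply q V x) i"
    unfolding tensor_apply_def[of p]
    by (intro sum.cong refl) (simp add: prod.list_conv_set_nth atLeast0LessThan)
  finally show "tensor_apply (1 + (p - 1) * (q - 1)) (tensor_comp p q U V) x i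
      = tensor_apply p U (tensor_apply q V x) i" .
qed

theorem proposition4p2:
  fixes U V :: "'n::finite tensor" and p q :: nat
  assumes "CARD('n) \<ge> 2" and "p \<ge> 2" and "q \<ge> 2"
  shows "Edet (1 + (p - 1) * (q - 1)) (tensor_comp p q U V) = 0 \<longleftrightarrow> Edet p U * Edet q V = 0"
proof -
  \<comment> \<open>The composition has order at least 2, hence forms of positive degree, as the
    zero criterion for \<open>Edet\<close> requires.\<close>
  have "1 * 1 \<le> (p - 1) * (q - 1)" using assms by (intro mult_le_mono) linarith+
  then have "2 \<le> 1 + (p - 1) * (q - 1)" by simp
  note comp = Edet_eq_0_iff[OF this, of "tensor_comp p q U V", unfolded tensor_apply_comp]
  show ?thesis
  proof
    assume "Edet (1 + (p - 1) * (q - 1)) (tensor_comp p q U V) = 0"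
    then obtain x where "x \<noteq> (\<lambda>_. 0)" "tensor_apply p U (tensor_apply q V x) = (\<lambda>_. 0)"
      unfolding comp by blast
    then have "Edet p U = 0 \<or> Edet q V = 0"
      using assms by (cases "tensor_apply q V x = (\<lambda>_. 0)") (auto simp: Edet_eq_0_iff)
    then show "Edet p U * Edet q V = 0" by simp
  next
    assume prod: "Edet p U * Edet q V = 0"
    have "\<exists>x. x \<noteq> (\<lambda>_. 0) \<and> tensor_apply p U (tensor_apply q V x) = (\<lambda>_. 0)"
    proof (cases "Edet q V = 0")
      case True
      then obtain x where "x \<noteq> (\<lambda>_. 0)" "tensor_apply q V x = (\<lambda>_. 0)"
        using assms by (auto simp: Edet_eq_0_iff)
      then show ?thesis
        using tensor_apply_zero[OF assms(2)] by (intro exI[of _ x]) auto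
    next
      case False
      with prod obtain y where y: "y \<noteq> (\<lambda>_. 0)" "tensor_apply p U y = (\<lambda>_. 0)"
        using assms by (auto simp: Edet_eq_0_iff)
      have "system_coeffs (tensor_form q V) \<notin> singular_systems (q - 1)"
        using False Edet_eq_0_iff_singular[OF assms(3)] by blast
      then obtain x where "\<forall>i. tensor_apply q V x i = y i"
        using nonsingular_system_surjective[of "q - 1" "system_coeffs (tensor_form q V)" y] assms
        unfolding form_eval_tensor_form by auto
      then have x: "tensor_apply q V x = y" by auto
      with y tensor_apply_zero[OF assms(3)] have "x \<noteq> (\<lambda>_. 0)" by auto
      with x y show ?thesis by auto
    qed
    then show "Edet (1 + (p - 1) * (q - 1)) (tensor_comp p q U V) = 0" by (simp only: comp)
  qed
qed

end
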